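(* Let $G$ be an abelian group and let $\mathcal{D}=M_n(\mathbb{C})$, regarded as a real algebra, with identity matrix $I$. Let $\Gamma$ be a division $G$-grading on $\mathcal{D}$ whose neutral component coincides with the center of $\mathcal{D}$, let $T$ be its support, and set $T_{[2]}=\{t\in T\mid t^2=e\}$. For an involution $\varphi$ of the graded algebra $\mathcal{D}$ with $\varphi(iI)=-iI$, put $$S=\{t\in T_{[2]}\mid \exists X\in\mathcal{D}_t\text{ such that }X^2=+I\text{ and }\varphi(X)=X\}.$$ Then assigning $S$ to $\varphi$ gives a bijective correspondence between the isomorphism classes of the pairs $(\Gamma,\varphi)$, where $\varphi$ runs through the involutions of the graded algebra $\mathcal{D}$ with $\varphi(iI)=-iI$, and the subgroups of $T_{[2]}$ of index $1$ or $2$.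
   Context: A grading on an algebra $\mathcal{D}$ by a group $G$ is a vector space decomposition $\mathcal{D}=\bigoplus_{g\in G}\mathcal{D}_g$ with $\mathcal{D}_g\mathcal{D}_h\subseteq\mathcal{D}_{gh}$. The support is the set of $g$ with $\mathcal{D}_g\neq0$, and the neutral component is $\mathcal{D}_e$. It is a division grading if every nonzero homogeneous element is invertible. An involution of the graded algebra $\mathcal{D}$ is a bijective $\mathbb{R}$-linear map $\varphi:\mathcal{D}\to\mathcal{D}$ with $\varphi(XY)=\varphi(Y)\varphi(X)$, $\varphi(\varphi(X))=X$ and $\varphi(\mathcal{D}_g)\subseteq\mathcal{D}_g$ for all $g$. The grading $\Gamma$ is fixed. Pairs $(\Gamma,\varphi)$ and $(\Gamma,\varphi')$ are isomorphic if there is an automorphism $\psi$ of the real algebra $\mathcal{D}$ with $\psi(\mathcal{D}_g)=\mathcal{D}_g$ for all $g\in G$ and $\varphi'\psi=\psi\varphi$. *)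

theory Defs
  imports "HOL-Analysis.Analysis" "HOL-Algebra.Coset"
begin

text \<open>
  The algebra \<open>M\<^sub>n(\<complex>)\<close>, regarded as a real algebra, is the type \<open>complex ^ 'n ^ 'n\<close> with its real vector
  space structure (so \<^const>\<open>subspace\<close> and \<^const>\<open>linear\<close> mean \<open>\<real>\<close>-subspace and \<open>\<real>\<close>-linear) and the
  matrix product \<open>**\<close>; the operation \<open>*\<close> of that type is the entrywise product and is not used.
  A grading is a family \<open>D\<close> of which only the values on \<open>carrier G\<close> matter.
\<close>

type_synonym 'n cmat = "complex ^ 'n ^ 'n"

text \<open>The second conjunct below says that the space is the internal direct sum of the \<open>D g\<close>:
  each matrix has exactly one decomposition into finitely many homogeneous components.\<close>

definition is_grading :: "('g, 'b) monoid_scheme \<Rightarrow> ('g \<Rightarrow> ('n::finite) cmat set) \<Rightarrow> bool" where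
  "is_grading G D \<longleftrightarrow>
     (\<forall>g\<in>carrier G. subspace (D g)) \<and>
     (\<forall>X. \<exists>!f. finite {g. f g \<noteq> 0} \<and> {g. f g \<noteq> 0} \<subseteq> carrier G \<and>
               (\<forall>g\<in>carrier G. f g \<in> D g) \<and> X = (\<Sum>g | f g \<noteq> 0. f g)) \<and>
     (\<forall>g\<in>carrier G. \<forall>h\<in>carrier G. \<forall>X\<in>D g. \<forall>Y\<in>D h. X ** Y \<in> D (g \<otimes>\<^bsub>G\<^esub> h))"

definition is_division_grading :: "('g, 'b) monoid_scheme \<Rightarrow> ('g \<Rightarrow> ('n::finite) cmat set) \<Rightarrow> bool" where
  "is_division_grading G D \<longleftrightarrow>
     is_grading G D \<and> (\<forall>g\<in>carrier G. \<forall>X\<in>D g. X \<noteq> 0 \<longrightarrow> invertible X)"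

definition grading_support :: "('g, 'b) monoid_scheme \<Rightarrow> ('g \<Rightarrow> ('n::finite) cmat set) \<Rightarrow> 'g set" where
  "grading_support G D = {g \<in> carrier G. D g \<noteq> {0}}"

definition matrix_center :: "('n::finite) cmat set" where
  "matrix_center = {Z. \<forall>X. Z ** X = X ** Z}"

definition support_2 :: "('g, 'b) monoid_scheme \<Rightarrow> ('g \<Rightarrow> ('n::finite) cmat set) \<Rightarrow> 'g set" where
  "support_2 G D = {t \<in> grading_support G D. t \<otimes>\<^bsub>G\<^esub> t = \<one>\<^bsub>G\<^esub>}"

definition is_graded_involution ::
    "('g, 'b) monoid_scheme \<Rightarrow> ('g \<Rightarrow> ('n::finite) cmat set) \<Rightarrow> ('n cmat \<Rightarrow> 'n cmat) \<Rightarrow> bool" where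
  "is_graded_involution G D \<phi> \<longleftrightarrow>
     bij \<phi> \<and> linear \<phi> \<and> (\<forall>X Y. \<phi> (X ** Y) = \<phi> Y ** \<phi> X) \<and> (\<forall>X. \<phi> (\<phi> X) = X) \<and>
     (\<forall>g\<in>carrier G. \<phi> ` D g \<subseteq> D g)"

text \<open>\<open>mat \<i>\<close> is the scalar matrix \<open>i I\<close>.\<close>

definition second_kind_involutions ::
    "('g, 'b) monoid_scheme \<Rightarrow> ('g \<Rightarrow> ('n::finite) cmat set) \<Rightarrow> ('n cmat \<Rightarrow> 'n cmat) set" where
  "second_kind_involutions G D = {\<phi>. is_graded_involution G D \<phi> \<and> \<phi> (mat \<i>) = - mat \<i>}"

definition is_graded_automorphism ::
    "('g, 'b) monoid_scheme \<Rightarrow> ('g \<Rightarrow> ('n::finite) cmat set) \<Rightarrow> ('n cmat \<Rightarrow> 'n cmat) \<Rightarrow> bool" where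
  "is_graded_automorphism G D \<psi> \<longleftrightarrow>
     bij \<psi> \<and> linear \<psi> \<and> (\<forall>X Y. \<psi> (X ** Y) = \<psi> X ** \<psi> Y) \<and> (\<forall>g\<in>carrier G. \<psi> ` D g = D g)"

definition iso_rel ::
    "('g, 'b) monoid_scheme \<Rightarrow> ('g \<Rightarrow> ('n::finite) cmat set) \<Rightarrow>
     (('n cmat \<Rightarrow> 'n cmat) \<times> ('n cmat \<Rightarrow> 'n cmat)) set" where
  "iso_rel G D =
     {(\<phi>, \<phi>'). \<phi> \<in> second_kind_involutions G D \<and> \<phi>' \<in> second_kind_involutions G D \<and>
                (\<exists>\<psi>. is_graded_automorphism G D \<psi> \<and> \<phi>' \<circ> \<psi> = \<psi> \<circ> \<phi>)}"

definition symmetric_support ::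
    "('g, 'b) monoid_scheme \<Rightarrow> ('g \<Rightarrow> ('n::finite) cmat set) \<Rightarrow> ('n cmat \<Rightarrow> 'n cmat) \<Rightarrow> 'g set" where
  "symmetric_support G D \<phi> =
     {t \<in> support_2 G D. \<exists>X\<in>D t. X ** X = mat 1 \<and> \<phi> X = X}"

definition subgroups_index_1_or_2 :: "('g, 'b) monoid_scheme \<Rightarrow> 'g set set" where
  "subgroups_index_1_or_2 H =
     {S. subgroup S H \<and> (card (rcosets\<^bsub>H\<^esub> S) = 1 \<or> card (rcosets\<^bsub>H\<^esub> S) = 2)}"

lemma equiv_iso_rel: "equiv (second_kind_involutions G D) (iso_rel G D)"
proof (rule equivI)
  show "refl_on (second_kind_involutions G D) (iso_rel G D)"
    unfolding refl_on_def iso_rel_def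
    by (auto simp: is_graded_automorphism_def linear_id[unfolded id_def] id_def bij_id[unfolded id_def]
             intro!: exI[of _ "\<lambda>x. x"])
  show "iso_rel G D \<subseteq> second_kind_involutions G D \<times> second_kind_involutions G D"
    unfolding iso_rel_def by auto
  show "sym (iso_rel G D)"
  proof (rule symI)
    fix \<phi> \<phi>' assume "(\<phi>, \<phi>') \<in> iso_rel G D"
    then obtain \<psi> where \<psi>: "is_graded_automorphism G D \<psi>" "\<phi>' \<circ> \<psi> = \<psi> \<circ> \<phi>"
      and mem: "\<phi> \<in> second_kind_involutions G D" "\<phi>' \<in> second_kind_involutions G D"
      unfolding iso_rel_def by auto
    have b: "bij \<psi>" and l: "linear \<psi>" and m: "\<And>X Y. \<psi> (X ** Y) = \<psi> X ** \<psi> Y"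
      and g: "\<And>g. g \<in> carrier G \<Longrightarrow> \<psi> ` D g = D g"
      using \<psi>(1) unfolding is_graded_automorphism_def by auto
    have i: "inv_into UNIV \<psi> (\<psi> X) = X" "\<psi> (inv_into UNIV \<psi> X) = X" for X
      using bij_is_inj[OF b] bij_is_surj[OF b] by (simp_all add: surj_f_inv_f)
    have "linear (inv_into UNIV \<psi>)"
    proof (rule linearI)
      show "inv_into UNIV \<psi> (X + Y) = inv_into UNIV \<psi> X + inv_into UNIV \<psi> Y" for X Y
        using i(1)[of "inv_into UNIV \<psi> X + inv_into UNIV \<psi> Y"]
        unfolding linear_add[OF l] i(2) .
      show "inv_into UNIV \<psi> (r *\<^sub>R X) = r *\<^sub>R inv_into UNIV \<psi> X" for r X
        using i(1)[of "r *\<^sub>R inv_into UNIV \<psi> X"] unfolding linear_scale[OF l] i(2) .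
    qed
    moreover have "inv_into UNIV \<psi> (X ** Y) = inv_into UNIV \<psi> X ** inv_into UNIV \<psi> Y" for X Y
      using i(1)[of "inv_into UNIV \<psi> X ** inv_into UNIV \<psi> Y"] unfolding m i(2) .
    moreover have "inv_into UNIV \<psi> ` D h = D h" if "h \<in> carrier G" for h
      using g[OF that] b by (metis bij_is_inj image_inv_f_f)
    ultimately have "is_graded_automorphism G D (inv_into UNIV \<psi>)"
      unfolding is_graded_automorphism_def using bij_imp_bij_inv[OF b] by blast
    moreover have "\<phi> \<circ> inv_into UNIV \<psi> = inv_into UNIV \<psi> \<circ> \<phi>'"
    proof
      fix X show "(\<phi> \<circ> inv_into UNIV \<psi>) X = (inv_into UNIV \<psi> \<circ> \<phi>') X"
        using fun_cong[OF \<psi>(2), of "inv_into UNIV \<psi> X"] by (simp add: i)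
    qed
    ultimately show "(\<phi>', \<phi>) \<in> iso_rel G D"
      using mem unfolding iso_rel_def by auto
  qed
  show "trans (iso_rel G D)"
  proof (rule transI)
    fix \<phi>1 \<phi>2 \<phi>3 assume "(\<phi>1, \<phi>2) \<in> iso_rel G D" "(\<phi>2, \<phi>3) \<in> iso_rel G D"
    then obtain \<psi> \<theta> where \<psi>: "is_graded_automorphism G D \<psi>" "\<phi>2 \<circ> \<psi> = \<psi> \<circ> \<phi>1"
      and \<theta>: "is_graded_automorphism G D \<theta>" "\<phi>3 \<circ> \<theta> = \<theta> \<circ> \<phi>2"
      and mem: "\<phi>1 \<in> second_kind_involutions G D" "\<phi>3 \<in> second_kind_involutions G D"
      unfolding iso_rel_def by auto
    have "is_graded_automorphism G D (\<theta> \<circ> \<psi>)"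
      using \<psi>(1) \<theta>(1) unfolding is_graded_automorphism_def
      by (simp add: bij_comp linear_compose flip: image_image)
    moreover have "\<phi>3 \<circ> (\<theta> \<circ> \<psi>) = (\<theta> \<circ> \<psi>) \<circ> \<phi>1"
      unfolding comp_assoc[symmetric] \<theta>(2) unfolding comp_assoc \<psi>(2) ..
    ultimately show "(\<phi>1, \<phi>3) \<in> iso_rel G D"
      using mem unfolding iso_rel_def by auto
  qed
qed

end

theory Submission imports Defs begin

text \<open>
  Each component \<open>D t\<close>, \<open>t \<in> T\<close>, is a complex line, and an involution \<open>\<phi>\<close> with \<open>\<phi>(iI) = -iI\<close> is
  antilinear, so its fixed elements in \<open>D t\<close> form a real line. For \<open>t\<^sup>2 = e\<close> their squares are real
  scalars of constant sign \<open>q t\<close>; \<open>q\<close> is a character of the 2-torsion of \<open>T\<close> with kernel \<open>S\<close>. Two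
  involutions differ by a character \<open>h\<close> of \<open>T\<close>, which multiplies \<open>q\<close> by the restriction of \<open>h\<close>, and
  they are isomorphic iff \<open>h\<close> is a square, that is, iff \<open>h\<close> is trivial on the 2-torsion. Since
  characters of subgroups extend, every sign character occurs once some involution exists; existence
  holds because its obstruction is a symmetric 2-cocycle of \<open>T\<close> with values in the divisible group
  \<open>\<complex>\<^sup>\<times>\<close>.
\<close>

section \<open>Characters of abelian groups\<close>

text \<open>Since an involution of this kind conjugates scalars, twisting it by a character
  \<open>h\<close> gives a map whose square is multiplication by \<open>h t * cnj (h t)\<close> on
  \<open>D t\<close>; the twist is an involution only if \<open>h\<close> has modulus one.
  Finiteness of the support supplies this: \<open>T\<close> is bounded by the real dimension of the
  algebra, and characters of finite groups are unimodular. The same fact explains the squares: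
  scaling by \<open>\<mu>\<close> intertwines an involution with its twist by \<open>h\<close> when
  \<open>h = \<mu> / cnj \<mu>\<close>, and this quotient is the square of \<open>\<mu>\<close>.
  Homogeneous elements need not commute, so the structure constants of the algebra are not
  symmetric. Taking determinants shows that the commutation factors have modulus one, and this is
  what makes the obstruction cocycle symmetric. Characters have to be extended over finitely many
  new elements only, so an induction replaces a maximality argument.\<close>

text \<open>Values off \<open>H\<close> are unconstrained, so restriction keeps the same function
  and an extension merely has to agree on \<open>H\<close>.\<close>

definition character_on :: "('a, 'b) monoid_scheme \<Rightarrow> 'a set \<Rightarrow> ('a \<Rightarrow> complex) \<Rightarrow> bool" where
  "character_on G H h \<longleftrightarrow>
     (\<forall>x\<in>H. h x \<noteq> 0) \<and> (\<forall>x\<in>H. \<forall>y\<in>H. h (x \<otimes>\<^bsub>G\<^esub> y) = h x * h y)"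

lemma character_on_nonzero: "character_on G H h \<Longrightarrow> x \<in> H \<Longrightarrow> h x \<noteq> 0"
  and character_on_mult:
    "character_on G H h \<Longrightarrow> x \<in> H \<Longrightarrow> y \<in> H \<Longrightarrow> h (x \<otimes>\<^bsub>G\<^esub> y) = h x * h y"
  by (auto simp: character_on_def)

lemma character_on_subset: "character_on G H h \<Longrightarrow> K \<subseteq> H \<Longrightarrow> character_on G K h"
  by (auto simp: character_on_def subset_iff)

context group
begin

lemma character_on_one:
  assumes "subgroup H G" "character_on G H h"
  shows "h \<one> = 1"
proof -
  have "\<one> \<in> H" using assms(1) by (rule subgroup.one_closed)
  then have "h \<one> * h \<one> = h \<one>" "h \<one> \<noteq> 0"
    using character_on_mult[OF assms(2), of \<one> \<one>] character_on_nonzero[OF assms(2)] by auto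
  then show ?thesis by simp
qed

lemma character_on_inv:
  assumes "subgroup H G" "character_on G H h" "x \<in> H"
  shows "h (inv x) = inverse (h x)"
proof -
  have "inv x \<in> H" and "x \<in> carrier G"
    using subgroup.m_inv_closed[OF assms(1,3)] subgroup.mem_carrier[OF assms(1,3)] by auto
  then have "h x * h (inv x) = 1"
    using character_on_mult[OF assms(2,3), of "inv x"] character_on_one[OF assms(1,2)] by simp
  then show ?thesis by (rule inverse_unique[symmetric])
qed

lemma character_on_nat_pow:
  assumes "subgroup H G" "character_on G H h" "x \<in> H"
  shows "x [^] (n::nat) \<in> H \<and> h (x [^] n) = h x ^ n"
  using assms
  by (induction n)
     (auto simp: character_on_one subgroup.one_closed subgroup.m_closed character_on_mult)

lemma character_on_int_pow:
  assumes "subgroup H G" "character_on G H h" "x \<in> H"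
  shows "x [^] (n::int) \<in> H \<and> h (x [^] n) = h x powi n"
proof (cases n)
  case (nonneg k)
  then show ?thesis using character_on_nat_pow[OF assms, of k] by (simp add: int_pow_int)
next
  case (neg k)
  have "x \<in> carrier G" using subgroup.mem_carrier[OF assms(1,3)] .
  moreover have "x [^] Suc k \<in> H" "h (x [^] Suc k) = h x ^ Suc k"
    using character_on_nat_pow[OF assms, of "Suc k"] by auto
  ultimately show ?thesis
    using assms(1,2) unfolding neg
    by (simp only: int_pow_neg_int power_int_minus character_on_inv[OF assms(1,2)] power_int_of_nat
          subgroup.m_inv_closed simp_thms)
qed

text \<open>Multiplying by an element at which the norm of \<open>h\<close> is maximal shows that no
  value exceeds 1 in norm; the same bound at \<open>inv x\<close> gives the reverse
  inequality.\<close>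

lemma character_on_norm:
  assumes "subgroup H G" "character_on G H h" "finite H" "x \<in> H"
  shows "norm (h x) = 1"
proof -
  define m where "m = Max ((\<lambda>y. norm (h y)) ` H)"
  have max: "norm (h y) \<le> m" if "y \<in> H" for y
    unfolding m_def using assms(3) that by simp
  have "m \<in> (\<lambda>y. norm (h y)) ` H"
    unfolding m_def using assms(3,4) by (intro Max_in) auto
  then obtain s where s: "s \<in> H" "norm (h s) = m" by auto
  have "m > 0" using s character_on_nonzero[OF assms(2)] by auto
  have le: "norm (h y) \<le> 1" if "y \<in> H" for y
  proof -
    have "norm (h y) * m \<le> m"
      using max[of "y \<otimes> s"] that s assms(1,2)
      by (simp add: character_on_mult subgroup.m_closed norm_mult)
    then show ?thesis using \<open>m > 0\<close> by simp
  qed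
  have "inverse (norm (h x)) \<le> 1"
    using le[of "inv x"] subgroup.m_inv_closed[OF assms(1,4)] character_on_inv[OF assms(1,2,4)]
    by (simp add: norm_inverse)
  then have "norm (h x) \<ge> 1"
    using character_on_nonzero[OF assms(2,4)] by (simp add: field_simps)
  with le[OF assms(4)] show ?thesis by simp
qed

text \<open>The exponents \<open>n\<close> with \<open>x\<^sup>n \<in> H\<close> are the multiples of some \<open>d\<close>, and \<open>\<complex>\<^sup>\<times>\<close> is divisible.\<close>

lemma ex_root_of_character:
  assumes H: "subgroup H G" and h: "character_on G H h" and x: "x \<in> carrier G"
  shows "\<exists>m. m \<noteq> 0 \<and> (\<forall>n::int. x [^] n \<in> H \<longrightarrow> h (x [^] n) = m powi n)"
proof (cases "\<exists>d::nat. d > 0 \<and> x [^] d \<in> H")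
  case True
  define d where "d = (LEAST d::nat. d > 0 \<and> x [^] d \<in> H)"
  have d: "d > 0" "x [^] d \<in> H" using LeastI_ex[OF True] unfolding d_def by auto
  obtain m where m: "m ^ d = h (x [^] d)"
    using exists_complex_root_nonzero[of "h (x [^] d)" d] d character_on_nonzero[OF h d(2)]
    by (metis less_numeral_extra(3))
  have "m \<noteq> 0" using m d character_on_nonzero[OF h] by (metis power_eq_0_iff)
  moreover have "h (x [^] n) = m powi n" if n: "x [^] n \<in> H" for n :: int
  proof -
    \<comment> \<open>The remainder of \<open>n\<close> modulo \<open>d\<close> is again an exponent
      whose power lies in \<open>H\<close>, so minimality of \<open>d\<close> forces it to be
      0.\<close>
    define r where "r = nat (n mod int d)"
    have r: "int r = n - int d * (n div int d)" and "r < d"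
      unfolding r_def using d(1) by (auto simp: minus_mult_div_eq_mod nat_less_iff)
    have xd: "x [^] (int d * k) \<in> H \<and> h (x [^] (int d * k)) = h (x [^] d) powi k" for k
      using character_on_int_pow[OF H h d(2), of k] x by (simp add: int_pow_pow flip: int_pow_int)
    have "x [^] int r \<in> H"
      unfolding r using x n xd H by (simp add: int_pow_diff subgroup.m_closed subgroup.m_inv_closed)
    then have "r = 0"
      using not_less_Least[of r "\<lambda>d. d > 0 \<and> x [^] d \<in> H"] \<open>r < d\<close>
      unfolding d_def by (auto simp: int_pow_int)
    then have n: "n = int d * (n div int d)" using r by simp
    have "m powi n = (m ^ d) powi (n div int d)"
      by (subst n) (simp add: power_int_mult)
    with xd[of "n div int d"] show ?thesis by (simp add: m flip: n)
  qed
  ultimately show ?thesis by blast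
next
  case False
  have "n = 0" if n: "x [^] n \<in> H" for n :: int
  proof (rule ccontr)
    assume "n \<noteq> 0"
    have "x [^] (- n) \<in> H" using n x H by (simp add: int_pow_neg subgroup.m_inv_closed)
    then have "x [^] nat \<bar>n\<bar> \<in> H" using n by (simp add: abs_if flip: int_pow_int)
    then show False using False \<open>n \<noteq> 0\<close> by (auto dest: spec[of _ "nat \<bar>n\<bar>"])
  qed
  \<comment> \<open>Only the exponent 0 imposes a condition, so any nonzero \<open>m\<close> would
    serve.\<close>
  then show ?thesis using character_on_one[OF H h] by (intro exI[of _ 1]) force
qed

end

context comm_group
begin

text \<open>Two expressions \<open>y \<otimes> x [^] n\<close> of one element differ by a power of
  \<open>x\<close> lying in \<open>H\<close>. The value \<open>m\<close> assigned to
  \<open>x\<close> by \<open>ex_root_of_character\<close> is compatible with \<open>h\<close> on all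
  such powers, so \<open>h y * m powi n\<close> is well defined.\<close>

lemma character_extend_one:
  assumes H: "subgroup H G" and h: "character_on G H h" and x: "x \<in> carrier G"
  shows "\<exists>K \<eta>. subgroup K G \<and> insert x H \<subseteq> K \<and> character_on G K \<eta> \<and> (\<forall>y\<in>H. \<eta> y = h y)"
proof -
  obtain m where m: "m \<noteq> 0" "\<And>n::int. x [^] n \<in> H \<Longrightarrow> h (x [^] n) = m powi n"
    using ex_root_of_character[OF assms] by blast
  define K where "K = {y \<otimes> x [^] n | y (n::int). y \<in> H}"
  define \<eta> where "\<eta> z = (SOME c. \<exists>y\<in>H. \<exists>n::int. z = y \<otimes> x [^] n \<and> c = h y * m powi n)" for z
  have Hc: "y \<in> carrier G" if "y \<in> H" for y using subgroup.mem_carrier[OF H that] .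
  have well: "h y * m powi n = h y' * m powi n'"
    if y: "y \<in> H" "y' \<in> H" and eq: "y \<otimes> x [^] n = y' \<otimes> x [^] n'" for y y' and n n' :: int
  proof -
    have "x [^] (n - n') = x [^] n \<otimes> inv (x [^] n')" using x by (simp add: int_pow_diff)
    also have "\<dots> = inv y \<otimes> (y \<otimes> x [^] n) \<otimes> inv (x [^] n')"
      using x y Hc by (simp flip: m_assoc)
    also have "\<dots> = inv y \<otimes> y'"
      unfolding eq using x y Hc by (simp add: m_assoc)
    finally have e: "x [^] (n - n') = inv y \<otimes> y'" .
    moreover have "inv y \<otimes> y' \<in> H" using y H by (simp add: subgroup.m_closed subgroup.m_inv_closed)
    ultimately have "h (inv y \<otimes> y') = m powi (n - n')" using m(2)[of "n - n'"] by simp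
    then have "inverse (h y) * h y' = m powi n / m powi n'"
      using y H h m(1)
      by (simp add: character_on_mult character_on_inv subgroup.m_inv_closed power_int_diff)
    then show ?thesis using character_on_nonzero[OF h y(1)] m(1) by (simp add: field_simps)
  qed
  have \<eta>: "\<eta> (y \<otimes> x [^] n) = h y * m powi n" if "y \<in> H" for y and n :: int
    unfolding \<eta>_def
    by (rule some_equality) (use that well[OF _ that] in metis)+
  have mul: "(y \<otimes> x [^] n) \<otimes> (y' \<otimes> x [^] n') = (y \<otimes> y') \<otimes> x [^] (n + n')"
    if "y \<in> H" "y' \<in> H" for y y' and n n' :: int
    using that Hc x by (simp add: int_pow_mult m_ac)
  have "subgroup K G"
  proof (rule subgroupI)
    show "K \<subseteq> carrier G" unfolding K_def using Hc x by auto
    show "K \<noteq> {}" unfolding K_def using subgroup.one_closed[OF H] by blast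
    show "inv a \<in> K" if a: "a \<in> K" for a
    proof -
      obtain y n where yn: "a = y \<otimes> x [^] (n::int)" "y \<in> H" using a unfolding K_def by blast
      then have "inv a = inv y \<otimes> x [^] (- n)" using Hc x by (simp add: inv_mult int_pow_neg)
      then show ?thesis unfolding K_def using subgroup.m_inv_closed[OF H yn(2)] by blast
    qed
    show "a \<otimes> b \<in> K" if ab: "a \<in> K" "b \<in> K" for a b
    proof -
      obtain y n y' n' where "a = y \<otimes> x [^] (n::int)" "y \<in> H" "b = y' \<otimes> x [^] (n'::int)" "y' \<in> H"
        using ab unfolding K_def by blast
      then show ?thesis unfolding K_def using mul[of y y' n n'] subgroup.m_closed[OF H, of y y'] by auto
    qed
  qed
  moreover have HK: "y \<in> K \<and> \<eta> y = h y" if "y \<in> H" for y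
    using \<eta>[of y 0] that Hc unfolding K_def by (auto intro!: exI[of _ y] exI[of _ "0::int"])
  moreover have "x \<in> K"
    unfolding K_def using x subgroup.one_closed[OF H]
    by (auto intro!: exI[of _ "\<one>"] exI[of _ "1::int"])
  moreover have "character_on G K \<eta>"
  proof -
    have "\<eta> (a \<otimes> b) = \<eta> a * \<eta> b" if ab: "a \<in> K" "b \<in> K" for a b
    proof -
      obtain y n y' n' where "a = y \<otimes> x [^] (n::int)" "y \<in> H" "b = y' \<otimes> x [^] (n'::int)" "y' \<in> H"
        using ab unfolding K_def by blast
      then show ?thesis
        using h H m(1) by (simp add: mul \<eta> subgroup.m_closed character_on_mult power_int_add)
    qed
    moreover have "\<eta> a \<noteq> 0" if "a \<in> K" for a
      using that m(1) character_on_nonzero[OF h] unfolding K_def by (auto simp: \<eta>)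
    ultimately show ?thesis unfolding character_on_def by blast
  qed
  ultimately show ?thesis by blast
qed

text \<open>The ambient group may be infinite, as it is for the group extension built from a cocycle
  below; there only finitely many representatives have to be adjoined.\<close>

lemma character_extend:
  assumes "finite F" "F \<subseteq> carrier G" "subgroup H G" "character_on G H h"
  shows "\<exists>K \<eta>. subgroup K G \<and> F \<union> H \<subseteq> K \<and> character_on G K \<eta> \<and> (\<forall>y\<in>H. \<eta> y = h y)"
  using assms(1,2)
proof (induction F)
  case empty
  then show ?case using assms by auto
next
  case (insert x F)
  then obtain K \<eta> where K: "subgroup K G" "F \<union> H \<subseteq> K" "character_on G K \<eta>" "\<forall>y\<in>H. \<eta> y = h y"
    by auto
  obtain L \<theta> where "subgroup L G" "insert x K \<subseteq> L" "character_on G L \<theta>" "\<forall>y\<in>K. \<theta> y = \<eta> y"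
    using character_extend_one[OF K(1,3), of x] insert.prems by auto
  then show ?case using K by (intro exI[of _ L] exI[of _ \<theta>]) auto
qed

text \<open>Elements with equal squares differ by an element killed by squaring, where
  \<open>h\<close> is trivial; hence \<open>h t\<close> depends only on
  \<open>t \<otimes> t\<close>. This yields a character \<open>\<mu>0\<close> of the subgroup of
  squares, and any extension of it to \<open>T\<close> is a square root of \<open>h\<close>.\<close>

lemma ex_character_sqrt:
  assumes T: "subgroup T G" "finite T" and h: "character_on G T h"
    and trivial: "\<And>t. t \<in> T \<Longrightarrow> t \<otimes> t = \<one> \<Longrightarrow> h t = 1"
  shows "\<exists>\<mu>. character_on G T \<mu> \<and> (\<forall>t\<in>T. \<mu> t * \<mu> t = h t)"
proof -
  interpret T: subgroup T G by (rule T)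
  define Q where "Q = (\<lambda>t. t \<otimes> t) ` T"
  define \<mu>0 where "\<mu>0 q = (SOME z. \<exists>t\<in>T. q = t \<otimes> t \<and> z = h t)" for q
  have well: "h s = h t" if s: "s \<in> T" and t: "t \<in> T" and eq: "s \<otimes> s = t \<otimes> t" for s t
  proof -
    have "(s \<otimes> inv t) \<otimes> (s \<otimes> inv t) = (s \<otimes> s) \<otimes> inv (t \<otimes> t)"
      using T.mem_carrier[OF s] T.mem_carrier[OF t] by (simp add: m_ac inv_mult)
    also have "\<dots> = \<one>" unfolding eq using t by simp
    finally have "h (s \<otimes> inv t) = 1" using s t by (intro trivial) auto
    then show ?thesis
      using s t character_on_mult[OF h s, of "inv t"] character_on_inv[OF T(1) h t]
        character_on_nonzero[OF h t] by (simp add: field_simps)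
  qed
  have \<mu>0: "\<mu>0 (t \<otimes> t) = h t" if t: "t \<in> T" for t
    unfolding \<mu>0_def
  proof (rule some_equality)
    show "\<exists>s\<in>T. t \<otimes> t = s \<otimes> s \<and> h t = h s" using t by blast
    show "z = h t" if z: "\<exists>s\<in>T. t \<otimes> t = s \<otimes> s \<and> z = h s" for z
    proof -
      obtain s where "s \<in> T" "t \<otimes> t = s \<otimes> s" "z = h s" using z by blast
      then show ?thesis using well[of s t] t by simp
    qed
  qed
  have sq: "(s \<otimes> s) \<otimes> (t \<otimes> t) = (s \<otimes> t) \<otimes> (s \<otimes> t)" if "s \<in> T" "t \<in> T" for s t
    using that[THEN T.mem_carrier] by (simp add: m_ac)
  have Q: "subgroup Q G"
  proof (rule subgroupI)
    show "Q \<subseteq> carrier G" unfolding Q_def by auto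
    show "Q \<noteq> {}" unfolding Q_def using T.one_closed by blast
    show "inv a \<in> Q" if a: "a \<in> Q" for a
    proof -
      obtain t where t: "t \<in> T" "a = t \<otimes> t" using a unfolding Q_def by blast
      then have "inv a = inv t \<otimes> inv t" by (simp add: inv_mult)
      then show ?thesis unfolding Q_def using t by blast
    qed
    show "a \<otimes> b \<in> Q" if ab: "a \<in> Q" "b \<in> Q" for a b
    proof -
      obtain s t where st: "s \<in> T" "t \<in> T" "a = s \<otimes> s" "b = t \<otimes> t"
        using ab unfolding Q_def by blast
      have "a \<otimes> b = (s \<otimes> t) \<otimes> (s \<otimes> t)" unfolding st(3,4) by (rule sq[OF st(1,2)])
      then show ?thesis unfolding Q_def by (rule image_eqI) (rule T.m_closed[OF st(1,2)])
    qed
  qed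
  have "character_on G Q \<mu>0"
    unfolding character_on_def Q_def
  proof (intro conjI ballI)
    show "\<mu>0 x \<noteq> 0" if x: "x \<in> (\<lambda>t. t \<otimes> t) ` T" for x
    proof -
      obtain t where "t \<in> T" "x = t \<otimes> t" using x by blast
      then show ?thesis by (simp add: \<mu>0 character_on_nonzero[OF h])
    qed
    show "\<mu>0 (x \<otimes> y) = \<mu>0 x * \<mu>0 y"
      if xy: "x \<in> (\<lambda>t. t \<otimes> t) ` T" "y \<in> (\<lambda>t. t \<otimes> t) ` T" for x y
    proof -
      obtain s t where st: "s \<in> T" "t \<in> T" and x: "x = s \<otimes> s" and y: "y = t \<otimes> t"
        using xy by blast
      show ?thesis
        unfolding x y sq[OF st] \<mu>0[OF T.m_closed[OF st]] \<mu>0[OF st(1)] \<mu>0[OF st(2)]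
        by (rule character_on_mult[OF h st])
    qed
  qed
  from character_extend[OF T(2) T.subset Q this]
  obtain K \<mu> where K: "T \<union> Q \<subseteq> K" "character_on G K \<mu>" "\<forall>y\<in>Q. \<mu> y = \<mu>0 y"
    by (elim exE conjE)
  have "\<mu> t * \<mu> t = h t" if "t \<in> T" for t
  proof -
    have "t \<in> K" using K(1) that by blast
    then have "\<mu> t * \<mu> t = \<mu> (t \<otimes> t)" using character_on_mult[OF K(2), of t t] by simp
    also have "\<dots> = \<mu>0 (t \<otimes> t)" using K(3) that unfolding Q_def by blast
    finally show ?thesis using \<mu>0[OF that] by simp
  qed
  then show ?thesis using character_on_subset[OF K(2), of T] K(1) by blast
qed

text \<open>The cocycle defines an abelian extension of the group by \<open>\<complex>\<^sup>\<times>\<close>, which splits since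
  \<open>\<complex>\<^sup>\<times>\<close> is divisible.\<close>

lemma symmetric_cocycle_is_coboundary:
  fixes f :: "'a \<Rightarrow> 'a \<Rightarrow> complex"
  assumes fin: "finite (carrier G)"
    and nz: "\<And>s t. s \<in> carrier G \<Longrightarrow> t \<in> carrier G \<Longrightarrow> f s t \<noteq> 0"
    and sym: "\<And>s t. s \<in> carrier G \<Longrightarrow> t \<in> carrier G \<Longrightarrow> f s t = f t s"
    and coc: "\<And>r s t. r \<in> carrier G \<Longrightarrow> s \<in> carrier G \<Longrightarrow> t \<in> carrier G \<Longrightarrow>
                f r s * f (r \<otimes> s) t = f s t * f r (s \<otimes> t)"
    and one: "\<And>t. t \<in> carrier G \<Longrightarrow> f \<one> t = 1"
  shows "\<exists>l. (\<forall>t\<in>carrier G. l t \<noteq> 0) \<and>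
             (\<forall>s\<in>carrier G. \<forall>t\<in>carrier G. l s * l t = f s t * l (s \<otimes> t))"
proof -
  \<comment> \<open>A pair \<open>(s, a)\<close> stands for \<open>a\<close> times a symbol
    \<open>u s\<close>, with \<open>u s * u t = f s t * u (s \<otimes> t)\<close>. The cocycle
    identity is associativity, symmetry is commutativity, and \<open>f \<one> t = 1\<close> makes
    \<open>(\<one>, 1)\<close> neutral.\<close>
  define E where "E = \<lparr>carrier = carrier G \<times> (UNIV - {0::complex}),
    monoid.mult = (\<lambda>(s, a) (t, b). (s \<otimes> t, a * b * f s t)), one = (\<one>, 1)\<rparr>"
  have E: "comm_group E"
  proof (rule comm_groupI)
    show "x \<otimes>\<^bsub>E\<^esub> y \<in> carrier E" if "x \<in> carrier E" "y \<in> carrier E" for x y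
      using that nz by (auto simp: E_def)
    show "\<one>\<^bsub>E\<^esub> \<in> carrier E" by (simp add: E_def)
    show "x \<otimes>\<^bsub>E\<^esub> y \<otimes>\<^bsub>E\<^esub> z = x \<otimes>\<^bsub>E\<^esub> (y \<otimes>\<^bsub>E\<^esub> z)"
      if "x \<in> carrier E" "y \<in> carrier E" "z \<in> carrier E" for x y z
      using that coc by (auto simp: E_def m_assoc)
    show "x \<otimes>\<^bsub>E\<^esub> y = y \<otimes>\<^bsub>E\<^esub> x" if "x \<in> carrier E" "y \<in> carrier E" for x y
      using that sym by (auto simp: E_def m_comm)
    show "\<one>\<^bsub>E\<^esub> \<otimes>\<^bsub>E\<^esub> x = x" if "x \<in> carrier E" for x
      using that one by (auto simp: E_def)
    show "\<exists>y\<in>carrier E. y \<otimes>\<^bsub>E\<^esub> x = \<one>\<^bsub>E\<^esub>" if "x \<in> carrier E" for x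
    proof -
      obtain t a where "x = (t, a)" "t \<in> carrier G" "a \<noteq> 0" using \<open>x \<in> carrier E\<close> by (auto simp: E_def)
      then show ?thesis
        using nz[of "inv t" t] by (intro bexI[of _ "(inv t, 1 / (a * f (inv t) t))"]) (auto simp: E_def)
    qed
  qed
  interpret E: comm_group E by (rule E)
  \<comment> \<open>This is the copy of the nonzero complex numbers, with \<open>snd\<close> as its
    identity character. An extension \<open>\<eta>\<close> of \<open>snd\<close> to the
    representatives \<open>(t, 1)\<close> splits the group extension, and \<open>l t\<close> will be
    \<open>\<eta> (t, 1)\<close>.\<close>
  define N where "N = {\<one>} \<times> (UNIV - {0::complex})"
  have "subgroup N E"
  proof (rule E.subgroupI)
    show "N \<subseteq> carrier E" "N \<noteq> {}" by (auto simp: N_def E_def)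
    show "x \<otimes>\<^bsub>E\<^esub> y \<in> N" if "x \<in> N" "y \<in> N" for x y
      using that one by (auto simp: N_def E_def)
    show "inv\<^bsub>E\<^esub> x \<in> N" if "x \<in> N" for x
    proof -
      obtain a where "x = (\<one>, a)" "a \<noteq> 0" using \<open>x \<in> N\<close> by (auto simp: N_def)
      then have "inv\<^bsub>E\<^esub> x = (\<one>, 1 / a)"
        using one by (intro E.inv_equality) (auto simp: E_def)
      then show ?thesis using \<open>a \<noteq> 0\<close> by (simp add: N_def)
    qed
  qed
  moreover have "character_on E N snd"
    using one by (auto simp: character_on_def N_def E_def)
  moreover have "finite (carrier G \<times> {1::complex})" using fin by simp
  moreover have "carrier G \<times> {1} \<subseteq> carrier E" by (auto simp: E_def)
  ultimately obtain K \<eta> where K: "subgroup K E" "carrier G \<times> {1} \<union> N \<subseteq> K" "character_on E K \<eta>"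
    "\<forall>y\<in>N. \<eta> y = snd y"
    using E.character_extend[of "carrier G \<times> {1}" N snd] by blast
  have "\<eta> (s, 1) * \<eta> (t, 1) = f s t * \<eta> (s \<otimes> t, 1)" if st: "s \<in> carrier G" "t \<in> carrier G" for s t
  proof -
    have n: "(\<one>, f s t) \<in> N" using nz st by (auto simp: N_def)
    have "\<eta> (s, 1) * \<eta> (t, 1) = \<eta> ((s, 1) \<otimes>\<^bsub>E\<^esub> (t, 1))"
      using K(2) st by (intro character_on_mult[OF K(3), symmetric]) auto
    also have "(s, 1) \<otimes>\<^bsub>E\<^esub> (t, 1) = (\<one>, f s t) \<otimes>\<^bsub>E\<^esub> (s \<otimes> t, 1)"
      using st one by (simp add: E_def)
    also have "\<eta> \<dots> = \<eta> (\<one>, f s t) * \<eta> (s \<otimes> t, 1)"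
      using K(2) st n by (intro character_on_mult[OF K(3)]) auto
    also have "\<eta> (\<one>, f s t) = f s t" using K(4) n by auto
    finally show ?thesis .
  qed
  moreover have "\<eta> (t, 1) \<noteq> 0" if "t \<in> carrier G" for t
    using character_on_nonzero[OF K(3)] K(2) that by auto
  ultimately show ?thesis by (intro exI[of _ "\<lambda>t. \<eta> (t, 1)"]) blast
qed

end

section \<open>Subgroups of index at most two\<close>

text \<open>The product \<open>x \<otimes> y\<close> lies in \<open>S\<close> exactly when
  \<open>x\<close> and \<open>inv y\<close> have the same right coset, so the condition expresses
  that there is at most one coset besides \<open>S\<close>.\<close>

lemma (in group) card_rcosets_1_or_2_iff:
  assumes "subgroup S G"
  shows "card (rcosets S) = 1 \<or> card (rcosets S) = 2 \<longleftrightarrow>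
         (\<forall>x\<in>carrier G - S. \<forall>y\<in>carrier G - S. x \<otimes> y \<in> S)"
proof
  interpret S: subgroup S G by (rule assms)
  have eqS: "S #> x = S \<longleftrightarrow> x \<in> S" if "x \<in> carrier G" for x
    using coset_join1[OF _ that assms] coset_join2[OF that assms] by blast
  have mem: "S #> x \<in> rcosets S" if "x \<in> carrier G" for x
    using rcosetsI[OF S.subset that] .
  have S_mem: "S \<in> rcosets S" using mem[of \<one>] eqS[of \<one>] by simp
  show "\<forall>x\<in>carrier G - S. \<forall>y\<in>carrier G - S. x \<otimes> y \<in> S"
    if card: "card (rcosets S) = 1 \<or> card (rcosets S) = 2"
  proof (intro ballI)
    fix x y assume x: "x \<in> carrier G - S" and y: "y \<in> carrier G - S"
    have ne: "S #> x \<noteq> S" "S #> inv y \<noteq> S"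
      using x y eqS S.m_inv_closed[of "inv y"] by auto
    have "S #> x = S #> inv y"
    proof (rule ccontr)
      assume "S #> x \<noteq> S #> inv y"
      then have "card {S, S #> x, S #> inv y} = 3" using ne by auto
      moreover have "card {S, S #> x, S #> inv y} \<le> card (rcosets S)"
        using card S_mem mem x y by (intro card_mono card_ge_0_finite) auto
      ultimately show False using card by linarith
    qed
    then have "x \<in> S #> inv y" using rcos_self[of x S] x assms by auto
    then show "x \<otimes> y \<in> S" using S.rcos_module_imp[OF is_group, of "inv y" x] y by simp
  qed
  show "card (rcosets S) = 1 \<or> card (rcosets S) = 2"
    if prod: "\<forall>x\<in>carrier G - S. \<forall>y\<in>carrier G - S. x \<otimes> y \<in> S"
  proof -
    have *: "S #> x = S #> y" if x: "x \<in> carrier G - S" and y: "y \<in> carrier G - S" for x y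
    proof -
      have "inv x \<notin> S"
      proof
        assume "inv x \<in> S"
        then have "inv (inv x) \<in> S" by (rule S.m_inv_closed)
        then show False using x by simp
      qed
      then have "inv x \<in> carrier G - S" using x by simp
      then have "y \<otimes> inv x \<in> S" using prod y by blast
      moreover have "y = y \<otimes> inv x \<otimes> x" using x y by (simp add: m_assoc)
      ultimately have "y \<in> S #> x" unfolding r_coset_def by blast
      then show ?thesis using repr_independence[of y S x] x assms by simp
    qed
    \<comment> \<open>If \<open>S\<close> is the whole group, the choice is arbitrary and
      \<open>C\<close> need not be a coset; hence the later distinction on
      \<open>C \<in> rcosets S\<close>.\<close>
    define C where "C = S #> (SOME x. x \<in> carrier G - S)"
    have "rcosets S \<subseteq> {S, C}"
    proof
      fix R assume "R \<in> rcosets S"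
      then obtain x where x: "x \<in> carrier G" "R = S #> x" unfolding RCOSETS_def by blast
      show "R \<in> {S, C}"
      proof (cases "x \<in> S")
        case True
        then show ?thesis using x eqS by simp
      next
        case False
        then have "x \<in> carrier G - S" using x by simp
        then have "(SOME x. x \<in> carrier G - S) \<in> carrier G - S" by (rule someI)
        with \<open>x \<in> carrier G - S\<close> have "S #> x = C" unfolding C_def by (rule *)
        then show ?thesis using x(2) by simp
      qed
    qed
    then have "rcosets S = {S} \<or> rcosets S = {S, C}"
      using S_mem by (cases "C \<in> rcosets S") auto
    then show ?thesis by (cases "S = C") (elim disjE; simp)+
  qed
qed

section \<open>Complex scalar multiplication of matrices\<close>

text \<open>Complex scalars act here as multiplication by the scalar matrix \<open>mat z\<close>,
  next to the real vector space structure in which gradings and involutions are phrased.\<close>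

definition cscale :: "complex \<Rightarrow> 'n::finite cmat \<Rightarrow> 'n cmat" (infixr "*\<^sub>C" 75) where
  "z *\<^sub>C A = (\<chi> i j. z * A $ i $ j)"

lemma cscale_mult_left [simp]: "(z *\<^sub>C A) ** B = z *\<^sub>C (A ** B)"
  and cscale_mult_right [simp]: "A ** (z *\<^sub>C B) = z *\<^sub>C (A ** B)"
  and cscale_cscale [simp]: "z *\<^sub>C (w *\<^sub>C A) = (z * w) *\<^sub>C A"
  and cscale_add_right: "z *\<^sub>C (A + B) = z *\<^sub>C A + z *\<^sub>C B"
  and cscale_add_left: "(z + w) *\<^sub>C A = z *\<^sub>C A + w *\<^sub>C A"
  and cscale_diff_left: "(z - w) *\<^sub>C A = z *\<^sub>C A - w *\<^sub>C A"
  and cscale_one [simp]: "1 *\<^sub>C A = A"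
  and cscale_zero_left [simp]: "0 *\<^sub>C A = 0"
  and cscale_zero_right [simp]: "z *\<^sub>C 0 = 0"
  and cscale_uminus: "(- z) *\<^sub>C A = - (z *\<^sub>C A)"
  and scaleR_eq_cscale: "r *\<^sub>R A = of_real r *\<^sub>C A"
  and mat_eq_cscale: "mat z = z *\<^sub>C (mat 1 :: 'n::finite cmat)"
  and cscale_scaleR: "z *\<^sub>C (r *\<^sub>R A) = r *\<^sub>R (z *\<^sub>C A)"
  for A B :: "'n::finite cmat"
  by (simp_all add: cscale_def matrix_matrix_mult_def vec_eq_iff mat_def sum_distrib_left
      algebra_simps scaleR_conv_of_real[where 'a = complex])

lemma cscale_eq_0_iff [simp]: "z *\<^sub>C A = 0 \<longleftrightarrow> z = 0 \<or> A = 0"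
  by (auto simp: cscale_def vec_eq_iff)

lemma cscale_cancel_right: "A \<noteq> 0 \<Longrightarrow> z *\<^sub>C A = w *\<^sub>C A \<longleftrightarrow> z = w"
  using cscale_diff_left[of z w A] cscale_eq_0_iff[of "z - w" A] by auto

lemma det_cscale: "det (z *\<^sub>C A) = z ^ CARD('n) * det A" for A :: "'n::finite cmat"
proof -
  have "z *\<^sub>C A = mat z ** A" by (simp add: mat_eq_cscale[of z])
  moreover have "det (mat z :: 'n cmat) = z ^ CARD('n)"
    by (subst det_diagonal) (simp_all add: mat_def)
  ultimately show ?thesis by (simp add: det_mul)
qed

lemma bilinear_matrix_mult: "bilinear ((**) :: 'n::finite cmat \<Rightarrow> 'n cmat \<Rightarrow> 'n cmat)"
  unfolding bilinear_def
  by (auto intro!: linearI simp: matrix_add_ldistrib scaleR_eq_cscale)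
     (simp add: matrix_matrix_mult_def vec_eq_iff sum.distrib algebra_simps)

lemma mat_1_neq_0: "(mat 1 :: 'n::finite cmat) \<noteq> 0"
  by (simp add: vec_eq_iff mat_def)

lemma matrix_center_eq: "matrix_center = range (\<lambda>z. z *\<^sub>C (mat 1 :: 'n::finite cmat))"
proof
  show "range (\<lambda>z. z *\<^sub>C mat 1) \<subseteq> (matrix_center :: 'n cmat set)"
    by (auto simp: matrix_center_def)
  show "matrix_center \<subseteq> range (\<lambda>z. z *\<^sub>C (mat 1 :: 'n cmat))"
  proof
    fix Z :: "'n cmat" assume "Z \<in> matrix_center"
    then have comm: "Z ** X = X ** Z" for X by (auto simp: matrix_center_def)
    have *: "Z $ a $ i = (if a = i then Z $ j $ j else 0)" for a i j
    proof -
      \<comment> \<open>For the matrix unit at position \<open>(i, j)\<close>, column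
        \<open>j\<close> of \<open>Z ** E\<close> is column \<open>i\<close> of \<open>Z\<close>,
        while column \<open>j\<close> of \<open>E ** Z\<close> has the single possibly nonzero entry
        \<open>Z $ j $ j\<close> in row \<open>i\<close>.\<close>
      define E :: "'n cmat" where "E = (\<chi> a b. if a = i \<and> b = j then 1 else 0)"
      have "(Z ** E) $ a $ j = Z $ a $ i"
        by (simp add: matrix_matrix_mult_def E_def if_distrib cong: if_cong)
      moreover have "(E ** Z) $ a $ j = (if a = i then Z $ j $ j else 0)"
        by (simp add: matrix_matrix_mult_def E_def if_distrib[of "\<lambda>x. x * _"] cong: if_cong)
      ultimately show ?thesis using comm[of E] by simp
    qed
    \<comment> \<open>Any diagonal entry would do, since they all agree.\<close>
    have "Z = (Z $ undefined $ undefined) *\<^sub>C mat 1"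
      unfolding vec_eq_iff
    proof (intro allI)
      fix a b show "Z $ a $ b = ((Z $ undefined $ undefined) *\<^sub>C mat 1) $ a $ b"
        using *[of a b undefined] by (simp add: cscale_def mat_def)
    qed
    then show "Z \<in> range (\<lambda>z. z *\<^sub>C mat 1)" by blast
  qed
qed

lemma invertible_mult_eq_0_iff: "invertible A \<Longrightarrow> A ** B = 0 \<longleftrightarrow> B = 0" for A B :: "'n::finite cmat"
proof -
  assume "invertible A"
  then obtain C where C: "C ** A = mat 1" unfolding invertible_def by blast
  then show ?thesis
    using matrix_mul_assoc[of C A B] by (auto simp: C bilinear_rzero[OF bilinear_matrix_mult])
qed

section \<open>Division gradings with central neutral component\<close>

locale central_division_grading = comm_group G
  for G :: "('g, 'b) monoid_scheme" (structure) +
  fixes D :: "'g \<Rightarrow> 'n::finite cmat set"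
  assumes division: "is_division_grading G D"
    and neutral: "D \<one> = matrix_center"
begin

abbreviation T :: "'g set" where "T \<equiv> grading_support G D"

abbreviation T2 :: "'g set" where "T2 \<equiv> support_2 G D"

lemma T_carrier: "t \<in> T \<Longrightarrow> t \<in> carrier G"
  by (simp add: grading_support_def)

lemma D_outside_T: "g \<in> carrier G \<Longrightarrow> g \<notin> T \<Longrightarrow> D g = {0}"
  by (simp add: grading_support_def)

lemma D_subspace: "g \<in> carrier G \<Longrightarrow> subspace (D g)"
  using division by (simp add: is_division_grading_def is_grading_def)

lemma D_mult:
  "g \<in> carrier G \<Longrightarrow> h \<in> carrier G \<Longrightarrow> X \<in> D g \<Longrightarrow> Y \<in> D h \<Longrightarrow> X ** Y \<in> D (g \<otimes> h)"
  using division by (simp add: is_division_grading_def is_grading_def)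

lemma D_invertible: "g \<in> carrier G \<Longrightarrow> X \<in> D g \<Longrightarrow> X \<noteq> 0 \<Longrightarrow> invertible X"
  using division by (simp add: is_division_grading_def)

lemma scalar_in_D: "z *\<^sub>C mat 1 \<in> D \<one>"
  by (simp add: neutral matrix_center_eq)

lemma D_neutral: "X \<in> D \<one> \<Longrightarrow> \<exists>z. X = z *\<^sub>C mat 1"
  by (auto simp: neutral matrix_center_eq)

lemma D_zero: "g \<in> carrier G \<Longrightarrow> 0 \<in> D g"
  by (rule subspace_0[OF D_subspace])

lemma D_cscale:
  assumes "g \<in> carrier G" "X \<in> D g"
  shows "z *\<^sub>C X \<in> D g"
  using D_mult[OF one_closed assms(1) scalar_in_D assms(2), of z] assms(1) by simp

lemma D_mult_eq_0:
  fixes Y :: "'n cmat"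
  assumes "g \<in> carrier G" "X \<in> D g" "X \<noteq> 0"
  shows "X ** Y = 0 \<longleftrightarrow> Y = 0"
  using invertible_mult_eq_0_iff[OF D_invertible[OF assms]] .

lemma ex1_decomposition:
  "\<exists>!f. finite {g. f g \<noteq> 0} \<and> {g. f g \<noteq> 0} \<subseteq> carrier G \<and>
        (\<forall>g\<in>carrier G. f g \<in> D g) \<and> X = (\<Sum>g | f g \<noteq> 0. f g)"
  using division by (simp add: is_division_grading_def is_grading_def)

text \<open>Uniqueness of the decomposition of 0: the family cut off outside \<open>A\<close>
  competes with the zero family.\<close>

lemma D_independent:
  assumes A: "finite A" "A \<subseteq> carrier G" and f: "\<And>g. g \<in> A \<Longrightarrow> f g \<in> D g"
    and sum: "(\<Sum>g\<in>A. f g) = 0" and g: "g \<in> A"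
  shows "f g = 0"
proof -
  define f' where "f' = (\<lambda>g. if g \<in> A then f g else 0)"
  have sub: "{g. f' g \<noteq> 0} \<subseteq> A" by (auto simp: f'_def)
  have "(\<Sum>g | f' g \<noteq> 0. f' g) = (\<Sum>g\<in>A. f g)"
    using A(1) sub by (intro sum.mono_neutral_cong_left) (auto simp: f'_def)
  then have s: "0 = (\<Sum>g | f' g \<noteq> 0. f' g)" using sum by simp
  have c: "\<forall>g\<in>carrier G. f' g \<in> D g" using f D_zero by (simp add: f'_def)
  have "f' = (\<lambda>_. 0)"
    by (rule ex1E[OF ex1_decomposition[of 0]], rule trans, erule allE, erule mp,
        intro conjI finite_subset[OF sub A(1)] order_trans[OF sub A(2)] c s)
       (rule sym, erule allE, erule mp, simp add: D_zero)
  then show ?thesis using g unfolding f'_def by metis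
qed

text \<open>Nonzero elements of distinct components are linearly independent over the reals, so
  their number is at most the real dimension of the matrix space.\<close>

lemma finite_T: "finite T"
proof (rule ccontr)
  assume "infinite T"
  then obtain A where A: "A \<subseteq> T" "finite A" "card A = Suc DIM('n cmat)"
    using infinite_arbitrarily_large by blast
  define B where "B t = (SOME X. X \<in> D t \<and> X \<noteq> 0)" for t
  have B: "B t \<in> D t" "B t \<noteq> 0" if "t \<in> A" for t
  proof -
    have "t \<in> T" using A(1) that by blast
    then have "\<exists>X. X \<in> D t \<and> X \<noteq> 0"
      using D_zero[of t] unfolding grading_support_def by blast
    from someI_ex[OF this] show "B t \<in> D t" "B t \<noteq> 0" by (auto simp: B_def)
  qed
  have sub: "A \<subseteq> carrier G" using A(1) T_carrier by blast
  have indep: "u s = 0" if u: "(\<Sum>t\<in>A. u t *\<^sub>R B t) = 0" and s: "s \<in> A" for u :: "'g \<Rightarrow> real" and s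
  proof -
    have "u s *\<^sub>R B s = 0"
      using D_independent[OF A(2) sub _ u s] B sub by (auto intro: subspace_scale[OF D_subspace])
    then show ?thesis using B[OF s] by simp
  qed
  \<comment> \<open>Independence of a set sees only the image of \<open>B\<close>, so distinct
    degrees must give distinct elements; a coincidence would be a relation with coefficients 1 and
    -1.\<close>
  have inj: "inj_on B A"
  proof (rule inj_onI, rule ccontr)
    fix s t assume st: "s \<in> A" "t \<in> A" "B s = B t" "s \<noteq> t"
    define u :: "'g \<Rightarrow> real" where "u r = (if r = s then 1 else if r = t then - 1 else 0)" for r
    have "(\<Sum>r\<in>A. u r *\<^sub>R B r) = (\<Sum>r\<in>{s, t}. u r *\<^sub>R B r)"
      using A(2) st by (intro sum.mono_neutral_right) (auto simp: u_def)
    also have "\<dots> = 0" using st by (simp add: u_def)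
    finally show False using indep[of u s] st(1) by (simp add: u_def)
  qed
  have "independent (B ` A)"
  proof
    assume "dependent (B ` A)"
    then obtain u v where u: "(\<Sum>v\<in>B ` A. u v *\<^sub>R v) = 0" "v \<in> B ` A" "u v \<noteq> 0"
      using A(2) by (auto simp: dependent_finite)
    then obtain s where "s \<in> A" "v = B s" by blast
    moreover have "(\<Sum>t\<in>A. u (B t) *\<^sub>R B t) = 0" using u(1) inj by (simp add: sum.reindex)
    ultimately show False using indep[of "\<lambda>t. u (B t)" s] u(3) by simp
  qed
  then have "card (B ` A) \<le> DIM('n cmat)" by (rule independent_bound[THEN conjunct2])
  then show False using A(3) inj by (simp add: card_image)
qed

lemma ex_nonzero: "t \<in> T \<Longrightarrow> \<exists>X\<in>D t. X \<noteq> 0"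
  using D_zero[OF T_carrier] unfolding grading_support_def by blast

lemma in_T: "t \<in> carrier G \<Longrightarrow> X \<in> D t \<Longrightarrow> X \<noteq> 0 \<Longrightarrow> t \<in> T"
  by (auto simp: grading_support_def)

lemma T_one: "\<one> \<in> T"
  using in_T[OF one_closed scalar_in_D[of 1]] mat_1_neq_0 by simp

lemma T_mult: "s \<in> T \<Longrightarrow> t \<in> T \<Longrightarrow> s \<otimes> t \<in> T"
proof -
  assume st: "s \<in> T" "t \<in> T"
  then obtain X Y where "X \<in> D s" "X \<noteq> 0" "Y \<in> D t" "Y \<noteq> 0" using ex_nonzero by blast
  then show ?thesis
    using in_T[of "s \<otimes> t" "X ** Y"] D_mult D_mult_eq_0 st[THEN T_carrier] by simp
qed

lemma T_subgroup: "subgroup T G"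
proof (rule subgroupI)
  show "T \<subseteq> carrier G" using T_carrier by blast
  show "T \<noteq> {}" using T_one by blast
  show "s \<otimes> t \<in> T" if "s \<in> T" "t \<in> T" for s t using that by (rule T_mult)
  show "inv t \<in> T" if t: "t \<in> T" for t
  proof -
    \<comment> \<open>Inverses come from counting: translation by \<open>t\<close> is an injective
      self-map of a finite set, so it hits \<open>\<one>\<close>.\<close>
    have "inj_on ((\<otimes>) t) T" using t T_carrier by (auto intro!: inj_onI)
    moreover have "(\<otimes>) t ` T \<subseteq> T" using T_mult[OF t] by blast
    ultimately have "(\<otimes>) t ` T = T" by (intro endo_inj_surj finite_T)
    then have "\<one> \<in> (\<otimes>) t ` T" using T_one by simp
    then obtain s where s: "s \<in> T" "t \<otimes> s = \<one>" by auto
    then have "inv t = s" using t T_carrier by (intro inv_equality) (auto simp: m_comm)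
    then show ?thesis using s by simp
  qed
qed

text \<open>Multiplying by a nonzero \<open>W\<close> of degree \<open>inv t\<close> moves
  \<open>D t\<close> into the neutral component, which consists of scalars. A combination of
  \<open>X\<close> and \<open>Y\<close> is then annihilated by \<open>W\<close>, hence is
  zero.\<close>

lemma homogeneous_proportional:
  assumes t: "t \<in> T" and X: "X \<in> D t" "X \<noteq> 0" and Y: "Y \<in> D t"
  shows "\<exists>z. Y = z *\<^sub>C X"
proof -
  have it: "inv t \<in> T" using subgroup.m_inv_closed[OF T_subgroup t] .
  obtain W where W: "W \<in> D (inv t)" "W \<noteq> 0" using ex_nonzero[OF it] by blast
  have W0: "W ** Z = 0 \<longleftrightarrow> Z = 0" for Z :: "'n cmat" using D_mult_eq_0[OF T_carrier[OF it] W] .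
  have in_D: "W ** Z \<in> D \<one>" if "Z \<in> D t" for Z
    using D_mult[OF T_carrier[OF it] T_carrier[OF t] W(1) that] T_carrier[OF t] by simp
  obtain a b where ab: "W ** X = a *\<^sub>C mat 1" "W ** Y = b *\<^sub>C mat 1"
    using D_neutral[OF in_D[OF X(1)]] D_neutral[OF in_D[OF Y]] by blast
  have "a \<noteq> 0" using W0[of X] X(2) ab(1) by auto
  then have "W ** (Y - (b / a) *\<^sub>C X) = 0"
    using ab by (simp add: bilinear_rsub[OF bilinear_matrix_mult])
  then show ?thesis using W0 by auto
qed

text \<open>Both products lie in the same complex line, which gives \<open>b\<close>; comparing
  determinants shows that \<open>b\<close> is a root of unity.\<close>

lemma homogeneous_commute:
  assumes s: "s \<in> T" and X: "X \<in> D s" and t: "t \<in> T" and Y: "Y \<in> D t"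
  shows "\<exists>b. norm b = 1 \<and> X ** Y = b *\<^sub>C (Y ** X)"
proof (cases "X = 0 \<or> Y = 0")
  case True
  then show ?thesis
    by (intro exI[of _ 1]) (auto simp: bilinear_rzero[OF bilinear_matrix_mult] bilinear_lzero[OF bilinear_matrix_mult])
next
  case False
  note c = T_carrier[OF s] T_carrier[OF t]
  have XY: "X ** Y \<in> D (s \<otimes> t)" using D_mult[OF c X Y] .
  have YX: "Y ** X \<in> D (s \<otimes> t)" using D_mult[OF c(2,1) Y X] m_comm[OF c] by simp
  have "Y ** X \<noteq> 0" using D_mult_eq_0[OF c(2) Y] False by simp
  then obtain b where b: "X ** Y = b *\<^sub>C (Y ** X)"
    using homogeneous_proportional[OF T_mult[OF s t] YX _ XY] by blast
  have "det X \<noteq> 0" "det Y \<noteq> 0"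
    using D_invertible[OF c(1) X] D_invertible[OF c(2) Y] False by (auto simp: invertible_det_nz)
  moreover have "det X * det Y = b ^ CARD('n) * (det Y * det X)"
    using arg_cong[OF b, of det] by (simp add: det_mul det_cscale)
  ultimately have "b ^ CARD('n) = 1" by simp
  then have "norm b = 1" using power_eq_1_iff[of b "CARD('n)"] by simp
  then show ?thesis using b by blast
qed

section \<open>Homogeneous components and maps defined degree by degree\<close>

text \<open>Indexing by the finite set \<open>T\<close> gives all decompositions one index set, in
  place of the element-dependent supports in \<open>is_grading\<close>.\<close>

definition component :: "'n cmat \<Rightarrow> 'g \<Rightarrow> 'n cmat" where
  "component X = (SOME f. (\<forall>t\<in>T. f t \<in> D t) \<and> (\<Sum>t\<in>T. f t) = X)"

lemma component_in_D: "t \<in> T \<Longrightarrow> component X t \<in> D t"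
  and sum_component: "(\<Sum>t\<in>T. component X t) = X"
proof -
  obtain f where f: "\<forall>g\<in>carrier G. f g \<in> D g" "X = (\<Sum>g | f g \<noteq> 0. f g)"
    "{g. f g \<noteq> 0} \<subseteq> carrier G"
    using ex1_implies_ex[OF ex1_decomposition[of X]] by blast
  have "{g. f g \<noteq> 0} \<subseteq> T" using f(1,3) in_T by blast
  then have "(\<Sum>t\<in>T. f t) = X"
    unfolding f(2) by (intro sum.mono_neutral_right finite_T) auto
  then have "\<exists>f. (\<forall>t\<in>T. f t \<in> D t) \<and> (\<Sum>t\<in>T. f t) = X"
    using f(1) T_carrier by blast
  from someI_ex[OF this] show "t \<in> T \<Longrightarrow> component X t \<in> D t" "(\<Sum>t\<in>T. component X t) = X"
    by (auto simp: component_def)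
qed

lemma component_eqI:
  assumes "\<And>t. t \<in> T \<Longrightarrow> f t \<in> D t" "(\<Sum>t\<in>T. f t) = X" "t \<in> T"
  shows "component X t = f t"
proof -
  have "component X t - f t = 0"
  proof (rule D_independent[OF finite_T])
    show "T \<subseteq> carrier G" using T_carrier by blast
    show "component X s - f s \<in> D s" if "s \<in> T" for s
      using component_in_D[OF that] assms(1)[OF that] D_subspace[OF T_carrier[OF that]]
      by (intro subspace_diff)
    show "(\<Sum>s\<in>T. component X s - f s) = 0"
      by (simp add: sum_subtractf sum_component assms(2))
  qed fact
  then show ?thesis by simp
qed

lemma component_homogeneous:
  assumes "s \<in> T" "X \<in> D s" "t \<in> T"
  shows "component X t = (if t = s then X else 0)"
  using assms finite_T D_zero T_carrier by (intro component_eqI) auto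

lemma linear_component:
  assumes "t \<in> T"
  shows "linear (\<lambda>X. component X t)"
proof (rule linearI)
  fix X Y and r :: real
  show "component (X + Y) t = component X t + component Y t"
  proof (rule component_eqI[OF _ _ assms])
    show "component X s + component Y s \<in> D s" if "s \<in> T" for s
      using that by (intro subspace_add[OF D_subspace[OF T_carrier]] component_in_D)
    show "(\<Sum>s\<in>T. component X s + component Y s) = X + Y"
      by (simp add: sum.distrib sum_component)
  qed
  show "component (r *\<^sub>R X) t = r *\<^sub>R component X t"
  proof (rule component_eqI[OF _ _ assms])
    show "r *\<^sub>R component X s \<in> D s" if "s \<in> T" for s
      using that by (intro subspace_scale[OF D_subspace[OF T_carrier]] component_in_D)
    show "(\<Sum>s\<in>T. r *\<^sub>R component X s) = r *\<^sub>R X"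
      by (simp add: sum_component flip: scaleR_right.sum)
  qed
qed

lemma linear_eq_on_homogeneous:
  assumes "linear f" "linear g" "\<And>t X. t \<in> T \<Longrightarrow> X \<in> D t \<Longrightarrow> f X = g X"
  shows "f X = g X"
proof -
  have "f (\<Sum>t\<in>T. component X t) = g (\<Sum>t\<in>T. component X t)"
    by (simp add: linear_sum[OF assms(1)] linear_sum[OF assms(2)] assms(3) component_in_D)
  then show ?thesis by (simp add: sum_component)
qed

lemma bilinear_eq_on_homogeneous:
  assumes "bilinear f" "bilinear g"
    "\<And>s t X Y. s \<in> T \<Longrightarrow> X \<in> D s \<Longrightarrow> t \<in> T \<Longrightarrow> Y \<in> D t \<Longrightarrow> f X Y = g X Y"
  shows "f X Y = g X Y"
proof (rule linear_eq_on_homogeneous[of "\<lambda>X. f X Y" "\<lambda>X. g X Y"])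
  show "linear (\<lambda>X. f X Y)" "linear (\<lambda>X. g X Y)"
    using assms(1,2) unfolding bilinear_def by blast+
  fix s X assume X: "s \<in> T" "X \<in> D s"
  show "f X Y = g X Y"
  proof (rule linear_eq_on_homogeneous[of "f X" "g X"])
    show "linear (f X)" "linear (g X)" using assms(1,2) unfolding bilinear_def by blast+
  qed (rule assms(3)[OF X])
qed

text \<open>Only the values of \<open>\<rho> t\<close> on \<open>D t\<close> matter, and real
  linearity there suffices, so the same device builds both scalings and an antilinear map.\<close>

definition extend :: "('g \<Rightarrow> 'n cmat \<Rightarrow> 'n cmat) \<Rightarrow> 'n cmat \<Rightarrow> 'n cmat" where
  "extend \<rho> X = (\<Sum>t\<in>T. \<rho> t (component X t))"

lemma linear_extend:
  assumes "\<And>t X Y. t \<in> T \<Longrightarrow> X \<in> D t \<Longrightarrow> Y \<in> D t \<Longrightarrow> \<rho> t (X + Y) = \<rho> t X + \<rho> t Y"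
    and "\<And>t X r. t \<in> T \<Longrightarrow> X \<in> D t \<Longrightarrow> \<rho> t (r *\<^sub>R X) = r *\<^sub>R \<rho> t X"
  shows "linear (extend \<rho>)"
  unfolding extend_def
  by (intro linearI)
     (simp_all add: linear_add[OF linear_component] linear_scale[OF linear_component] assms
       component_in_D sum.distrib scaleR_right.sum)

lemma extend_homogeneous:
  assumes "t \<in> T" "X \<in> D t" "\<And>s. s \<in> T \<Longrightarrow> \<rho> s 0 = 0"
  shows "extend \<rho> X = \<rho> t X"
proof -
  have "extend \<rho> X = (\<Sum>s\<in>T. if s = t then \<rho> t X else 0)"
    unfolding extend_def using assms by (intro sum.cong) (auto simp: component_homogeneous)
  then show ?thesis using finite_T assms(1) by simp
qed

subsection \<open>Automorphisms and involutions\<close>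

abbreviation involutions :: "('n cmat \<Rightarrow> 'n cmat) set" where
  "involutions \<equiv> second_kind_involutions G D"

text \<open>This is the usual action of the dual group: a character acts on a graded algebra by
  scaling the components.\<close>

definition twist :: "('g \<Rightarrow> complex) \<Rightarrow> 'n cmat \<Rightarrow> 'n cmat" where
  "twist \<mu> = extend (\<lambda>t X. \<mu> t *\<^sub>C X)"

lemma linear_twist: "linear (twist \<mu>)"
  unfolding twist_def by (rule linear_extend) (simp_all add: cscale_add_right cscale_scaleR)

lemma twist_homogeneous: "t \<in> T \<Longrightarrow> X \<in> D t \<Longrightarrow> twist \<mu> X = \<mu> t *\<^sub>C X"
  unfolding twist_def by (simp add: extend_homogeneous)

lemma bilinear_compose_mult:
  fixes f :: "'n cmat \<Rightarrow> 'n cmat"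
  assumes "linear f"
  shows "bilinear (\<lambda>X Y :: 'n cmat. f (X ** Y))" "bilinear (\<lambda>X Y :: 'n cmat. f (Y ** X))"
    "bilinear (\<lambda>X Y :: 'n cmat. f X ** f Y)" "bilinear (\<lambda>X Y :: 'n cmat. f Y ** f X)"
proof -
  have l: "linear (\<lambda>X :: 'n cmat. X ** Y)" and r: "linear (\<lambda>X :: 'n cmat. Y ** X)" for Y :: "'n cmat"
    using bilinear_matrix_mult[where 'n = 'n] unfolding bilinear_def by blast+
  note c = linear_compose[OF l assms, unfolded o_def] linear_compose[OF r assms, unfolded o_def]
    linear_compose[OF assms l, unfolded o_def] linear_compose[OF assms r, unfolded o_def]
  show "bilinear (\<lambda>X Y :: 'n cmat. f (X ** Y))" "bilinear (\<lambda>X Y :: 'n cmat. f (Y ** X))"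
    "bilinear (\<lambda>X Y :: 'n cmat. f X ** f Y)" "bilinear (\<lambda>X Y :: 'n cmat. f Y ** f X)"
    unfolding bilinear_def by (intro conjI allI c)+
qed

lemma twist_mult:
  assumes "character_on G T \<mu>"
  shows "twist \<mu> (X ** Y) = twist \<mu> X ** twist \<mu> Y"
proof (rule bilinear_eq_on_homogeneous[OF bilinear_compose_mult(1,3)[OF linear_twist]])
  fix s t X Y assume *: "s \<in> T" "X \<in> D s" "t \<in> T" "Y \<in> D t"
  then have "X ** Y \<in> D (s \<otimes> t)" "s \<otimes> t \<in> T"
    using D_mult T_carrier T_mult by auto
  then show "twist \<mu> (X ** Y) = twist \<mu> X ** twist \<mu> Y"
    using * by (simp add: twist_homogeneous character_on_mult[OF assms] mult.commute)
qed

lemma twist_twist: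
  assumes "\<And>t. t \<in> T \<Longrightarrow> \<mu> t * \<nu> t = 1"
  shows "twist \<mu> (twist \<nu> X) = X"
  using linear_compose[OF linear_twist linear_twist, unfolded o_def] linear_ident
proof (rule linear_eq_on_homogeneous)
  fix t X assume "t \<in> T" "X \<in> D t"
  then show "twist \<mu> (twist \<nu> X) = X"
    using assms by (simp add: twist_homogeneous D_cscale T_carrier)
qed

lemma twist_automorphism:
  assumes \<mu>: "character_on G T \<mu>"
  shows "is_graded_automorphism G D (twist \<mu>)"
proof -
  have nz: "\<mu> t \<noteq> 0" if "t \<in> T" for t using character_on_nonzero[OF \<mu> that] .
  have inv: "twist (\<lambda>t. inverse (\<mu> t)) (twist \<mu> X) = X"
    "twist \<mu> (twist (\<lambda>t. inverse (\<mu> t)) X) = X" for X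
    by (rule twist_twist; simp add: nz)+
  have "bij (twist \<mu>)"
    by (rule o_bij[of "twist (\<lambda>t. inverse (\<mu> t))"]) (auto simp: inv fun_eq_iff)
  moreover have "twist \<mu> ` D g = D g" if g: "g \<in> carrier G" for g
  proof (cases "g \<in> T")
    case True
    have sub: "twist \<nu> ` D g \<subseteq> D g" for \<nu>
      using True g by (auto simp: twist_homogeneous D_cscale)
    have "X \<in> twist \<mu> ` D g" if "X \<in> D g" for X
      using inv(2)[of X, symmetric] sub that by blast
    with sub show ?thesis by blast
  next
    case False
    then show ?thesis using D_outside_T[OF g False] by (simp add: linear_0[OF linear_twist])
  qed
  ultimately show ?thesis
    unfolding is_graded_automorphism_def by (simp add: linear_twist twist_mult[OF \<mu>])
qed

lemma involutionD:
  assumes "\<phi> \<in> involutions"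
  shows involution_linear: "linear \<phi>"
    and involution_mult: "\<phi> (X ** Y) = \<phi> Y ** \<phi> X"
    and involution_involution: "\<phi> (\<phi> X) = X"
    and involution_in_D: "g \<in> carrier G \<Longrightarrow> X \<in> D g \<Longrightarrow> \<phi> X \<in> D g"
    and involution_ii: "\<phi> (mat \<i>) = - mat \<i>"
  using assms unfolding second_kind_involutions_def is_graded_involution_def
  by (simp_all add: image_subset_iff)

text \<open>Real linearity is given, and the imaginary unit is handled by applying
  \<open>\<phi>\<close> to the product of \<open>mat \<i>\<close> and \<open>X\<close>.\<close>

lemma involution_cscale:
  assumes "\<phi> \<in> involutions"
  shows "\<phi> (z *\<^sub>C X) = cnj z *\<^sub>C \<phi> X"
proof -
  have i: "\<phi> (\<i> *\<^sub>C X) = - \<i> *\<^sub>C \<phi> X"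
    using involution_mult[OF assms, of "mat \<i>" X] involution_ii[OF assms]
    by (simp add: mat_eq_cscale[of \<i>] flip: cscale_uminus)
  have *: "w *\<^sub>C Y = Re w *\<^sub>R Y + Im w *\<^sub>R (\<i> *\<^sub>C Y)" for w and Y :: "'n cmat"
  proof -
    have "w = of_real (Re w) + of_real (Im w) * \<i>" by (simp add: complex_eq_iff)
    then have "w *\<^sub>C Y = (of_real (Re w) + of_real (Im w) * \<i>) *\<^sub>C Y" by simp
    also have "\<dots> = Re w *\<^sub>R Y + Im w *\<^sub>R (\<i> *\<^sub>C Y)"
      by (simp only: scaleR_eq_cscale cscale_add_left cscale_cscale)
    finally show ?thesis .
  qed
  show ?thesis
    unfolding *[of z X] linear_add[OF involution_linear[OF assms]]
      linear_scale[OF involution_linear[OF assms]] i *[of "cnj z"]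
    by (simp add: cscale_uminus)
qed

lemma involutionI:
  assumes lin: "linear \<phi>"
    and mult: "\<And>s t X Y. s \<in> T \<Longrightarrow> X \<in> D s \<Longrightarrow> t \<in> T \<Longrightarrow> Y \<in> D t \<Longrightarrow> \<phi> (X ** Y) = \<phi> Y ** \<phi> X"
    and in_D: "\<And>t X. t \<in> T \<Longrightarrow> X \<in> D t \<Longrightarrow> \<phi> X \<in> D t"
    and invol: "\<And>t X. t \<in> T \<Longrightarrow> X \<in> D t \<Longrightarrow> \<phi> (\<phi> X) = X"
    and ii: "\<phi> (mat \<i>) = - mat \<i>"
  shows "\<phi> \<in> involutions"
proof -
  have invol': "\<phi> (\<phi> X) = X" for X
    using linear_compose[OF lin lin, unfolded o_def] linear_ident
    by (rule linear_eq_on_homogeneous) (rule invol)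
  have "bij \<phi>" by (rule o_bij[of \<phi>]) (auto simp: invol' fun_eq_iff)
  moreover have "\<phi> (X ** Y) = \<phi> Y ** \<phi> X" for X Y
    by (rule bilinear_eq_on_homogeneous[OF bilinear_compose_mult(1,4)[OF lin]]) (rule mult)
  moreover have "\<phi> ` D g \<subseteq> D g" if g: "g \<in> carrier G" for g
    using in_D D_outside_T[OF g] linear_0[OF lin] by (cases "g \<in> T") auto
  ultimately show ?thesis
    unfolding second_kind_involutions_def is_graded_involution_def using lin invol' ii by simp
qed

text \<open>Applying the twisted map twice multiplies \<open>D t\<close> by
  \<open>h t * cnj (h t)\<close>, because \<open>\<phi>\<close> conjugates the first factor; this is
  1 by \<open>character_on_norm\<close>.\<close>

lemma twist_involution:
  assumes \<phi>: "\<phi> \<in> involutions" and h: "character_on G T h"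
  shows "twist h \<circ> \<phi> \<in> involutions"
proof (rule involutionI)
  show "linear (twist h \<circ> \<phi>)" using involution_linear[OF \<phi>] linear_twist by (rule linear_compose)
  show "(twist h \<circ> \<phi>) (X ** Y) = (twist h \<circ> \<phi>) Y ** (twist h \<circ> \<phi>) X" for X Y
    by (simp add: involution_mult[OF \<phi>] twist_mult[OF h])
  have \<phi>D: "\<phi> X \<in> D t" if "t \<in> T" "X \<in> D t" for t X
    using involution_in_D[OF \<phi> T_carrier] that by blast
  show D: "(twist h \<circ> \<phi>) X \<in> D t" if "t \<in> T" "X \<in> D t" for t X
    using that \<phi>D D_cscale T_carrier by (simp add: twist_homogeneous)
  show "(twist h \<circ> \<phi>) ((twist h \<circ> \<phi>) X) = X" if "t \<in> T" "X \<in> D t" for t X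
  proof -
    have "h t * cnj (h t) = 1"
      using character_on_norm[OF T_subgroup h finite_T that(1)] complex_norm_square[of "h t"] by simp
    then show ?thesis
      using that \<phi>D D_cscale T_carrier
      by (simp add: twist_homogeneous involution_cscale[OF \<phi>] involution_involution[OF \<phi>])
  qed
  have "- mat \<i> \<in> D \<one>" using scalar_in_D[of "- \<i>"] by (simp add: mat_eq_cscale[of \<i>] cscale_uminus)
  then show "(twist h \<circ> \<phi>) (mat \<i>) = - mat \<i>"
    by (simp add: involution_ii[OF \<phi>] twist_homogeneous[OF T_one] character_on_one[OF T_subgroup h])
qed

section \<open>Fixed elements of an involution and their squares\<close>

text \<open>Symmetrise a nonzero \<open>X\<close> to \<open>X + \<phi> X\<close>. If this vanishes,
  \<open>X\<close> is skew, and antilinearity makes \<open>\<i> *\<^sub>C X\<close> fixed.\<close>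

lemma ex_fixed_homogeneous:
  assumes \<phi>: "\<phi> \<in> involutions" and t: "t \<in> T"
  shows "\<exists>X\<in>D t. X \<noteq> 0 \<and> \<phi> X = X"
proof -
  obtain X where X: "X \<in> D t" "X \<noteq> 0" using ex_nonzero[OF t] by blast
  show ?thesis
  proof (cases "X + \<phi> X = 0")
    case False
    have "X + \<phi> X \<in> D t"
      using X(1) involution_in_D[OF \<phi> T_carrier[OF t]]
      by (intro subspace_add[OF D_subspace[OF T_carrier[OF t]]])
    moreover have "\<phi> (X + \<phi> X) = X + \<phi> X"
      by (simp add: linear_add[OF involution_linear[OF \<phi>]] involution_involution[OF \<phi>])
    ultimately show ?thesis using False by blast
  next
    case True
    then have "\<phi> X = (- 1) *\<^sub>C X" by (simp add: cscale_uminus eq_neg_iff_add_eq_0 add.commute)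
    then have "\<phi> (\<i> *\<^sub>C X) = \<i> *\<^sub>C X"
      by (simp add: involution_cscale[OF \<phi>])
    then show ?thesis
      using D_cscale[OF T_carrier[OF t] X(1), of \<i>] X(2)
      by (intro bexI[of _ "\<i> *\<^sub>C X"] conjI) simp_all
  qed
qed

lemma T2_iff: "t \<in> T2 \<longleftrightarrow> t \<in> T \<and> t \<otimes> t = \<one>"
  by (simp add: support_2_def)

text \<open>The square of a fixed element of \<open>D t\<close> is a scalar matrix fixed by
  \<open>\<phi>\<close>, so the scalar equals its conjugate.\<close>

lemma ex_fixed_square:
  assumes \<phi>: "\<phi> \<in> involutions" and t: "t \<in> T2"
  shows "\<exists>X e. X \<in> D t \<and> \<phi> X = X \<and> e \<noteq> 0 \<and> X ** X = of_real e *\<^sub>C mat 1"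
proof -
  have tT: "t \<in> T" "t \<otimes> t = \<one>" using t by (auto simp: T2_iff)
  obtain X where X: "X \<in> D t" "X \<noteq> 0" "\<phi> X = X" using ex_fixed_homogeneous[OF \<phi> tT(1)] by blast
  have "X ** X \<in> D \<one>" using D_mult[OF T_carrier T_carrier X(1) X(1)] tT by simp
  then obtain z where z: "X ** X = z *\<^sub>C mat 1" using D_neutral by blast
  have "z \<noteq> 0" using D_mult_eq_0[OF T_carrier[OF tT(1)] X(1,2), of X] X(2) z by auto
  have "\<phi> (mat 1) = mat 1"
    using involution_mult[OF \<phi>, of "mat 1" "\<phi> (mat 1)"] involution_involution[OF \<phi>, of "mat 1"]
    by simp
  then have "cnj z *\<^sub>C (mat 1 :: 'n cmat) = z *\<^sub>C mat 1"
    using involution_mult[OF \<phi>, of X X] X(3) z by (simp add: involution_cscale[OF \<phi>])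
  then have "cnj z = z" by (simp only: cscale_cancel_right[OF mat_1_neq_0])
  then have "z = of_real (Re z)" by (simp add: complex_eq_iff)
  then have "Re z \<noteq> 0" "X ** X = of_real (Re z) *\<^sub>C mat 1" using z \<open>z \<noteq> 0\<close> by auto
  then show ?thesis using X by blast
qed

text \<open>The fixed elements of a component form a real line, so the sign of their squares is
  well defined.\<close>

lemma symmetric_support_iff:
  assumes \<phi>: "\<phi> \<in> involutions" and t: "t \<in> T2"
    and X: "X \<in> D t" "\<phi> X = X" "X ** X = of_real e *\<^sub>C mat 1" "e \<noteq> 0"
  shows "t \<in> symmetric_support G D \<phi> \<longleftrightarrow> e > 0"
proof
  have tT: "t \<in> T" using t by (simp add: T2_iff)
  have X0: "X \<noteq> 0" using X(3,4) mat_1_neq_0 by (auto simp: bilinear_lzero[OF bilinear_matrix_mult])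
  show "e > 0" if "t \<in> symmetric_support G D \<phi>"
  proof -
    obtain Y where Y: "Y \<in> D t" "Y ** Y = mat 1" "\<phi> Y = Y"
      using \<open>t \<in> symmetric_support G D \<phi>\<close> by (auto simp: symmetric_support_def)
    obtain z where z: "Y = z *\<^sub>C X" using homogeneous_proportional[OF tT X(1) X0 Y(1)] by blast
    have "cnj z *\<^sub>C X = z *\<^sub>C X" using Y(3) X(2) by (simp add: z involution_cscale[OF \<phi>])
    then have "cnj z = z" by (simp only: cscale_cancel_right[OF X0])
    then have "z = of_real (Re z)" by (simp add: complex_eq_iff)
    then obtain r where r: "z = of_real r" by blast
    have "(z * (z * of_real e)) *\<^sub>C (mat 1 :: 'n cmat) = 1 *\<^sub>C mat 1"
      using Y(2) X(3) by (simp add: z)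
    then have "z * (z * of_real e) = 1" by (simp only: cscale_cancel_right[OF mat_1_neq_0])
    then have "of_real (r * r * e) = (1 :: complex)" by (simp add: r mult.assoc)
    then have "r * r * e = 1" by (simp only: of_real_eq_1_iff)
    then show "e > 0" using mult_nonneg_nonpos[of "r * r" e] by (intro not_le_imp_less notI) simp
  qed
  show "t \<in> symmetric_support G D \<phi>" if "e > 0"
  proof -
    \<comment> \<open>The factor is real, so \<open>Y\<close> stays fixed while its square is
      normalised to the identity.\<close>
    define Y where "Y = of_real (1 / sqrt e) *\<^sub>C X"
    have "1 / sqrt e * (1 / sqrt e) * e = 1" using \<open>e > 0\<close> by (simp add: field_simps)
    then have "Y ** Y = mat 1"
      unfolding Y_def using X(3) by (simp flip: of_real_mult)
    moreover have "Y \<in> D t" unfolding Y_def by (rule D_cscale[OF T_carrier[OF tT] X(1)])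
    moreover have "\<phi> Y = Y" unfolding Y_def using X(2) by (simp add: involution_cscale[OF \<phi>])
    ultimately show ?thesis using t by (auto simp: symmetric_support_def)
  qed
qed

subsection \<open>The subgroup attached to an involution\<close>

lemma T2_subgroup: "subgroup T2 G"
proof (rule subgroupI)
  interpret T: subgroup T G by (rule T_subgroup)
  show "T2 \<subseteq> carrier G" by (auto simp: T2_iff)
  have "\<one> \<in> T2" by (simp add: T2_iff)
  then show "T2 \<noteq> {}" by blast
  show "inv t \<in> T2" if "t \<in> T2" for t
  proof -
    have t: "t \<in> T" "t \<otimes> t = \<one>" using that by (simp_all add: T2_iff)
    then have "inv t = t" by (intro inv_equality) auto
    then show ?thesis using \<open>t \<in> T2\<close> by simp
  qed
  show "s \<otimes> t \<in> T2" if "s \<in> T2" "t \<in> T2" for s t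
  proof -
    have st: "s \<in> T" "s \<otimes> s = \<one>" "t \<in> T" "t \<otimes> t = \<one>" using that by (simp_all add: T2_iff)
    have "(s \<otimes> t) \<otimes> (s \<otimes> t) = (s \<otimes> s) \<otimes> (t \<otimes> t)"
      using st(1,3)[THEN T_carrier] by (simp only: m_ac m_closed)
    then show ?thesis using st by (simp add: T2_iff)
  qed
qed

lemma T2_carrier: "t \<in> T2 \<Longrightarrow> t \<in> carrier G"
  using subgroup.mem_carrier[OF T2_subgroup] .

text \<open>The right-hand side says that the function equal to 1 on \<open>S\<close> and -1 on the
  rest of \<open>T2\<close> is multiplicative. It thus identifies these subgroups with the sign
  characters of \<open>T2\<close>.\<close>

lemma index_1_or_2_iff:
  "S \<in> subgroups_index_1_or_2 (G\<lparr>carrier := T2\<rparr>) \<longleftrightarrow>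
     S \<subseteq> T2 \<and> (\<forall>s\<in>T2. \<forall>t\<in>T2. s \<otimes> t \<in> S \<longleftrightarrow> (s \<in> S \<longleftrightarrow> t \<in> S))"
  (is "_ \<longleftrightarrow> ?R")
proof -
  interpret T2: subgroup T2 G by (rule T2_subgroup)
  interpret H: group "G\<lparr>carrier := T2\<rparr>" by (rule subgroup_imp_group[OF T2_subgroup])
  have sq: "t \<otimes> t = \<one>" if "t \<in> T2" for t using that by (simp add: T2_iff)
  have "S \<in> subgroups_index_1_or_2 (G\<lparr>carrier := T2\<rparr>) \<longleftrightarrow>
      subgroup S (G\<lparr>carrier := T2\<rparr>) \<and> (\<forall>s\<in>T2 - S. \<forall>t\<in>T2 - S. s \<otimes> t \<in> S)"
    using H.card_rcosets_1_or_2_iff[of S] by (auto simp: subgroups_index_1_or_2_def)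
  also have "\<dots> \<longleftrightarrow> ?R"
  proof
    assume L: "subgroup S (G\<lparr>carrier := T2\<rparr>) \<and> (\<forall>s\<in>T2 - S. \<forall>t\<in>T2 - S. s \<otimes> t \<in> S)"
    then have S: "subgroup S G" and "S \<subseteq> T2"
      using incl_subgroup[OF T2_subgroup, of S] subgroup.subset[of S "G\<lparr>carrier := T2\<rparr>"] by auto
    have out: "s \<otimes> t \<notin> S" if "s \<in> S" "t \<in> T2" "t \<notin> S" for s t
    proof
      assume "s \<otimes> t \<in> S"
      then have "s \<otimes> (s \<otimes> t) \<in> S" using subgroup.m_closed[OF S \<open>s \<in> S\<close>] by blast
      moreover have "s \<otimes> (s \<otimes> t) = t"
        using that(1,2) \<open>S \<subseteq> T2\<close> sq[of s] by (simp add: subset_iff flip: m_assoc)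
      ultimately show False using that(3) by simp
    qed
    have "s \<otimes> t \<in> S \<longleftrightarrow> (s \<in> S \<longleftrightarrow> t \<in> S)" if st: "s \<in> T2" "t \<in> T2" for s t
    proof (cases "s \<in> S"; cases "t \<in> S")
      assume "s \<notin> S" "t \<in> S"
      then show ?thesis using out[of t s] m_comm[of s t] st by simp
    qed (use out[of s t] st L subgroup.m_closed[OF S, of s t] in auto)
    then show ?R using \<open>S \<subseteq> T2\<close> by blast
  next
    assume R: ?R
    have "subgroup S G"
    proof (rule subgroupI)
      show "S \<subseteq> carrier G" using R T2.subset by blast
      \<comment> \<open>Taking both arguments to be \<open>\<one>\<close> makes the right-hand
        equivalence trivially true, which rules out the empty set.\<close>
      have "\<one> \<otimes> \<one> \<in> S \<longleftrightarrow> True" using R T2.one_closed by blast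
      then show "S \<noteq> {}" by blast
      show "inv s \<in> S" if "s \<in> S" for s
      proof -
        have "s \<in> T2" using that R by blast
        then have "inv s = s" using sq by (intro inv_equality) auto
        then show ?thesis using that by simp
      qed
      show "s \<otimes> t \<in> S" if "s \<in> S" "t \<in> S" for s t
        using that R by blast
    qed
    then show "subgroup S (G\<lparr>carrier := T2\<rparr>) \<and> (\<forall>s\<in>T2 - S. \<forall>t\<in>T2 - S. s \<otimes> t \<in> S)"
      using R subgroup_incl[OF _ T2_subgroup, of S] by blast
  qed
  finally show ?thesis .
qed

text \<open>If \<open>X\<close> and \<open>Y\<close> are fixed by the involution and \<open>YX = \<plusminus>XY\<close>, then \<open>XY\<close> or \<open>iXY\<close> is fixed, and
  its square is \<open>X\<^sup>2Y\<^sup>2\<close> in both cases.\<close>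

lemma symmetric_support_mult:
  assumes \<phi>: "\<phi> \<in> involutions" and s: "s \<in> T2" and t: "t \<in> T2"
  shows "s \<otimes> t \<in> symmetric_support G D \<phi> \<longleftrightarrow>
         (s \<in> symmetric_support G D \<phi> \<longleftrightarrow> t \<in> symmetric_support G D \<phi>)"
proof -
  obtain X d where X: "X \<in> D s" "\<phi> X = X" "d \<noteq> 0" "X ** X = of_real d *\<^sub>C mat 1"
    using ex_fixed_square[OF \<phi> s] by blast
  obtain Y e where Y: "Y \<in> D t" "\<phi> Y = Y" "e \<noteq> 0" "Y ** Y = of_real e *\<^sub>C mat 1"
    using ex_fixed_square[OF \<phi> t] by blast
  have T: "s \<in> T" "t \<in> T" using s t by (simp_all add: T2_iff)
  obtain b where b: "Y ** X = b *\<^sub>C (X ** Y)"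
    using homogeneous_commute[OF T(2) Y(1) T(1) X(1)] by blast
  have Y0: "Y \<noteq> 0" using Y(3,4) mat_1_neq_0 by (auto simp: bilinear_lzero[OF bilinear_matrix_mult])
  \<comment> \<open>Moving \<open>Y\<close> past the scalar matrix \<open>X ** X\<close> one factor
    at a time costs \<open>b\<close> twice, so \<open>b * b = 1\<close>.\<close>
  have "of_real d *\<^sub>C Y = Y ** (X ** X)" using X(4) by simp
  also have "\<dots> = (b *\<^sub>C (X ** Y)) ** X" unfolding matrix_mul_assoc b[symmetric] ..
  also have "\<dots> = b *\<^sub>C (X ** (Y ** X))" by (simp add: matrix_mul_assoc)
  also have "X ** (Y ** X) = b *\<^sub>C ((X ** X) ** Y)" unfolding b by (simp add: matrix_mul_assoc)
  also have "b *\<^sub>C \<dots> = (b * b * of_real d) *\<^sub>C Y" using X(4) by (simp add: mult.assoc)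
  finally have "b * b = 1" using X(3) by (simp add: cscale_cancel_right[OF Y0])
  then have b1: "b = 1 \<or> b = - 1" by (simp add: square_eq_1_iff)
  \<comment> \<open>Of the two identities, \<open>cnj c * b = c\<close> makes \<open>Z\<close> fixed
    by \<open>\<phi>\<close>, and \<open>c * c = b\<close> cancels the factor \<open>b\<close> that
    arises in squaring \<open>X ** Y\<close>.\<close>
  define c where "c = (if b = 1 then 1 else \<i>)"
  have c: "c * c = b" "cnj c * b = c" using b1 by (auto simp: c_def)
  define Z where "Z = c *\<^sub>C (X ** Y)"
  have "(X ** Y) ** (X ** Y) = X ** (Y ** X) ** Y" by (simp add: matrix_mul_assoc)
  also have "\<dots> = b *\<^sub>C ((X ** X) ** (Y ** Y))" unfolding b by (simp add: matrix_mul_assoc)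
  also have "\<dots> = (b * of_real (d * e)) *\<^sub>C mat 1" using X(4) Y(4) by (simp add: mult.commute)
  finally have "Z ** Z = (c * c * b * of_real (d * e)) *\<^sub>C mat 1" by (simp add: Z_def mult.assoc)
  also have "c * c * b = 1" using c(1) \<open>b * b = 1\<close> by simp
  finally have ZZ: "Z ** Z = of_real (d * e) *\<^sub>C mat 1" by simp
  have "\<phi> Z = Z"
    by (simp add: Z_def involution_cscale[OF \<phi>] involution_mult[OF \<phi>] X(2) Y(2) b c(2))
  moreover have "Z \<in> D (s \<otimes> t)"
    unfolding Z_def using T T_carrier X(1) Y(1) by (intro D_cscale D_mult m_closed)
  ultimately have "s \<otimes> t \<in> symmetric_support G D \<phi> \<longleftrightarrow> d * e > 0"
    using symmetric_support_iff[OF \<phi> subgroup.m_closed[OF T2_subgroup s t] _ _ ZZ] X(3) Y(3) by simp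
  then show ?thesis
    using symmetric_support_iff[OF \<phi> s X(1,2,4,3)] symmetric_support_iff[OF \<phi> t Y(1,2,4,3)] X(3) Y(3)
    by (auto simp: zero_less_mult_iff)
qed

lemma symmetric_support_index:
  assumes "\<phi> \<in> involutions"
  shows "symmetric_support G D \<phi> \<in> subgroups_index_1_or_2 (G\<lparr>carrier := T2\<rparr>)"
proof -
  have "symmetric_support G D \<phi> \<subseteq> T2" by (auto simp: symmetric_support_def)
  then show ?thesis unfolding index_1_or_2_iff using symmetric_support_mult[OF assms] by simp
qed

lemma character_on_T2:
  assumes h: "character_on G T h" and t: "t \<in> T2"
  shows "h t = 1 \<or> h t = - 1"
proof -
  have "t \<in> T" "t \<otimes> t = \<one>" using t by (simp_all add: T2_iff)
  then have "h t * h t = 1"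
    using character_on_mult[OF h, of t t] character_on_one[OF T_subgroup h] by simp
  then show ?thesis by (simp add: square_eq_1_iff)
qed

text \<open>Where \<open>h t = - 1\<close>, an element \<open>X\<close> fixed by
  \<open>\<phi>\<close> becomes skew for the twist; then \<open>\<i> *\<^sub>C X\<close> is fixed,
  and its square has the opposite sign.\<close>

lemma symmetric_support_twist:
  assumes \<phi>: "\<phi> \<in> involutions" and h: "character_on G T h" and t: "t \<in> T2"
  shows "t \<in> symmetric_support G D (twist h \<circ> \<phi>) \<longleftrightarrow>
         (t \<in> symmetric_support G D \<phi> \<longleftrightarrow> h t = 1)"
proof -
  obtain X e where X: "X \<in> D t" "\<phi> X = X" "e \<noteq> 0" "X ** X = of_real e *\<^sub>C mat 1"
    using ex_fixed_square[OF \<phi> t] by blast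
  have T: "t \<in> T" using t by (simp add: T2_iff)
  note \<phi>' = twist_involution[OF \<phi> h]
  have fixed: "(twist h \<circ> \<phi>) (c *\<^sub>C X) = (h t * cnj c) *\<^sub>C X" for c
    by (simp add: involution_cscale[OF \<phi>] X(2) twist_homogeneous[OF T] D_cscale[OF T_carrier[OF T] X(1)])
  show ?thesis
  proof (cases "h t = 1")
    case True
    have "t \<in> symmetric_support G D (twist h \<circ> \<phi>) \<longleftrightarrow> e > 0"
      using fixed[of 1] True by (intro symmetric_support_iff[OF \<phi>' t X(1) _ X(4,3)]) simp
    then show ?thesis using symmetric_support_iff[OF \<phi> t X(1,2,4,3)] True by simp
  next
    case False
    then have ht: "h t = - 1" using character_on_T2[OF h t] by simp
    have "t \<in> symmetric_support G D (twist h \<circ> \<phi>) \<longleftrightarrow> - e > 0"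
    proof (rule symmetric_support_iff[OF \<phi>' t])
      show "\<i> *\<^sub>C X \<in> D t" using D_cscale[OF T_carrier[OF T] X(1)] .
      show "(twist h \<circ> \<phi>) (\<i> *\<^sub>C X) = \<i> *\<^sub>C X" using fixed[of \<i>] ht by simp
      show "(\<i> *\<^sub>C X) ** (\<i> *\<^sub>C X) = of_real (- e) *\<^sub>C mat 1" using X(4) by simp
    qed (use X(3) in simp)
    then show ?thesis using symmetric_support_iff[OF \<phi> t X(1,2,4,3)] False X(3) by auto
  qed
qed

section \<open>Classification of the involutions up to isomorphism\<close>

text \<open>The composite of \<open>\<phi>\<close> and \<open>\<phi>'\<close> is multiplicative and
  complex linear, so it acts on each line \<open>D t\<close> by a scalar \<open>h t\<close>;
  composing with \<open>\<phi>\<close> once more recovers \<open>\<phi>'\<close>.\<close>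

lemma involutions_differ_by_twist:
  assumes \<phi>: "\<phi> \<in> involutions" and \<phi>': "\<phi>' \<in> involutions"
  shows "\<exists>h. character_on G T h \<and> \<phi>' = twist h \<circ> \<phi>"
proof -
  have in_D: "\<phi> X \<in> D t" "\<phi>' (\<phi> X) \<in> D t" if "t \<in> T" "X \<in> D t" for t X
    using that involution_in_D[OF \<phi>] involution_in_D[OF \<phi>'] T_carrier by simp_all
  have nz: "\<phi>' (\<phi> X) \<noteq> 0" if "X \<noteq> 0" for X
  proof
    assume "\<phi>' (\<phi> X) = 0"
    then have "\<phi> (\<phi>' (\<phi>' (\<phi> X))) = 0"
      by (simp add: linear_0[OF involution_linear[OF \<phi>]] linear_0[OF involution_linear[OF \<phi>']])
    then show False using that by (simp add: involution_involution[OF \<phi>] involution_involution[OF \<phi>'])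
  qed
  have "\<exists>c. \<forall>X\<in>D t. \<phi>' (\<phi> X) = c *\<^sub>C X" if t: "t \<in> T" for t
  proof -
    obtain X where X: "X \<in> D t" "X \<noteq> 0" using ex_nonzero[OF t] by blast
    obtain c where c: "\<phi>' (\<phi> X) = c *\<^sub>C X"
      using homogeneous_proportional[OF t X in_D(2)[OF t X(1)]] by blast
    have "\<phi>' (\<phi> Y) = c *\<^sub>C Y" if Y: "Y \<in> D t" for Y
    proof -
      obtain z where "Y = z *\<^sub>C X" using homogeneous_proportional[OF t X Y] by blast
      then show ?thesis
        by (simp add: involution_cscale[OF \<phi>] involution_cscale[OF \<phi>'] c mult.commute)
    qed
    then show ?thesis by blast
  qed
  then obtain h where h: "\<And>t X. t \<in> T \<Longrightarrow> X \<in> D t \<Longrightarrow> \<phi>' (\<phi> X) = h t *\<^sub>C X" by metis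
  have "character_on G T h"
    unfolding character_on_def
  proof (intro conjI ballI)
    fix s assume s: "s \<in> T"
    then obtain X where X: "X \<in> D s" "X \<noteq> 0" using ex_nonzero by blast
    show "h s \<noteq> 0" using nz[OF X(2)] h[OF s X(1)] by auto
    fix t assume t: "t \<in> T"
    then obtain Y where Y: "Y \<in> D t" "Y \<noteq> 0" using ex_nonzero by blast
    have XY: "X ** Y \<noteq> 0" using D_mult_eq_0[OF T_carrier[OF s] X] Y(2) by simp
    have "h (s \<otimes> t) *\<^sub>C (X ** Y) = \<phi>' (\<phi> (X ** Y))"
      using h[OF T_mult[OF s t]] D_mult[OF T_carrier[OF s] T_carrier[OF t] X(1) Y(1)] by simp
    also have "\<dots> = \<phi>' (\<phi> X) ** \<phi>' (\<phi> Y)"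
      by (simp add: involution_mult[OF \<phi>] involution_mult[OF \<phi>'])
    also have "\<dots> = (h s * h t) *\<^sub>C (X ** Y)"
      using h[OF s X(1)] h[OF t Y(1)] by (simp add: mult.commute)
    finally show "h (s \<otimes> t) = h s * h t" by (simp only: cscale_cancel_right[OF XY])
  qed
  moreover have "\<phi>' X = twist h (\<phi> X)" for X
    using involution_linear[OF \<phi>'] linear_compose[OF involution_linear[OF \<phi>] linear_twist, unfolded o_def]
  proof (rule linear_eq_on_homogeneous)
    fix t X assume t: "t \<in> T" "X \<in> D t"
    then show "\<phi>' X = twist h (\<phi> X)"
      using h[OF t(1) in_D(1)[OF t]] in_D(1)[OF t]
      by (simp add: twist_homogeneous[OF t(1)] involution_involution[OF \<phi>])
  qed
  ultimately show ?thesis by (intro exI[of _ h]) auto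
qed

text \<open>The isomorphism is \<open>twist \<mu>\<close> for a square root \<open>\<mu>\<close> of
  \<open>h\<close>: intertwining requires \<open>h t * cnj (\<mu> t) = \<mu> t\<close>, which holds
  as \<open>\<mu>\<close> is unimodular.\<close>

lemma iso_rel_twist:
  assumes \<phi>: "\<phi> \<in> involutions" and h: "character_on G T h"
    and trivial: "\<And>t. t \<in> T2 \<Longrightarrow> h t = 1"
  shows "(\<phi>, twist h \<circ> \<phi>) \<in> iso_rel G D"
proof -
  obtain \<mu> where \<mu>: "character_on G T \<mu>" "\<forall>t\<in>T. \<mu> t * \<mu> t = h t"
    using ex_character_sqrt[OF T_subgroup finite_T h] trivial by (auto simp: T2_iff)
  note lin = involution_linear[OF \<phi>] linear_twist
  have "twist h (\<phi> (twist \<mu> X)) = twist \<mu> (\<phi> X)" for X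
  proof (rule linear_eq_on_homogeneous[of "\<lambda>X. twist h (\<phi> (twist \<mu> X))" "\<lambda>X. twist \<mu> (\<phi> X)"])
    show "linear (\<lambda>X. twist h (\<phi> (twist \<mu> X)))" "linear (\<lambda>X. twist \<mu> (\<phi> X))"
      using linear_compose[OF linear_compose[OF lin(2,1)] lin(2)] linear_compose[OF lin]
      by (simp_all add: o_def)
    fix t X assume t: "t \<in> T" "X \<in> D t"
    have \<phi>X: "\<phi> X \<in> D t" using involution_in_D[OF \<phi> T_carrier[OF t(1)] t(2)] .
    have "\<mu> t * cnj (\<mu> t) = 1"
      using character_on_norm[OF T_subgroup \<mu>(1) finite_T t(1)] complex_norm_square[of "\<mu> t"] by simp
    then have "h t * cnj (\<mu> t) = \<mu> t" using \<mu>(2) t(1) by (metis mult.assoc mult.right_neutral)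
    then show "twist h (\<phi> (twist \<mu> X)) = twist \<mu> (\<phi> X)"
      using t \<phi>X D_cscale[OF T_carrier[OF t(1)] \<phi>X]
      by (simp add: twist_homogeneous[OF t(1)] involution_cscale[OF \<phi>])
  qed
  then have "(twist h \<circ> \<phi>) \<circ> twist \<mu> = twist \<mu> \<circ> \<phi>" by (simp add: fun_eq_iff)
  then show ?thesis
    using \<phi> twist_involution[OF \<phi> h] twist_automorphism[OF \<mu>(1)] unfolding iso_rel_def by blast
qed

text \<open>Equal supports force the twisting character to be 1 on \<open>T2\<close>. Conversely, an
  intertwining graded automorphism carries fixed square roots of the identity in \<open>D t\<close>
  to such elements; this inclusion is used both ways, by symmetry of \<open>iso_rel\<close>.\<close>

lemma iso_rel_iff:
  assumes \<phi>: "\<phi> \<in> involutions" and \<phi>': "\<phi>' \<in> involutions"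
  shows "(\<phi>, \<phi>') \<in> iso_rel G D \<longleftrightarrow> symmetric_support G D \<phi> = symmetric_support G D \<phi>'"
proof
  assume "symmetric_support G D \<phi> = symmetric_support G D \<phi>'"
  moreover obtain h where h: "character_on G T h" and \<phi>'_eq: "\<phi>' = twist h \<circ> \<phi>"
    using involutions_differ_by_twist[OF assms] by blast
  ultimately have "h t = 1" if "t \<in> T2" for t
    using symmetric_support_twist[OF \<phi> h that] by blast
  then show "(\<phi>, \<phi>') \<in> iso_rel G D" unfolding \<phi>'_eq by (rule iso_rel_twist[OF \<phi> h])
next
  have sub: "symmetric_support G D \<phi> \<subseteq> symmetric_support G D \<phi>'" if iso: "(\<phi>, \<phi>') \<in> iso_rel G D" for \<phi> \<phi>'
  proof
    fix t assume "t \<in> symmetric_support G D \<phi>"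
    then obtain X where t: "t \<in> T2" and X: "X \<in> D t" "X ** X = mat 1" "\<phi> X = X"
      by (auto simp: symmetric_support_def)
    obtain \<psi> where \<psi>: "is_graded_automorphism G D \<psi>" "\<phi>' \<circ> \<psi> = \<psi> \<circ> \<phi>"
      using iso by (auto simp: iso_rel_def)
    have b: "bij \<psi>" and m: "\<And>X Y. \<psi> (X ** Y) = \<psi> X ** \<psi> Y" and im: "\<psi> ` D t = D t"
      using \<psi>(1) T2_carrier[OF t] by (simp_all add: is_graded_automorphism_def)
    obtain E where "\<psi> E = mat 1" using bij_is_surj[OF b] by (metis surjE)
    then have "\<psi> (mat 1) = mat 1" using m[of "mat 1" E] by simp
    then have "\<psi> X ** \<psi> X = mat 1" using m[of X X] X(2) by simp
    moreover have "\<psi> X \<in> D t" using im X(1) by blast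
    moreover have "\<phi>' (\<psi> X) = \<psi> X" using fun_cong[OF \<psi>(2), of X] X(3) by simp
    ultimately show "t \<in> symmetric_support G D \<phi>'" using t by (auto simp: symmetric_support_def)
  qed
  assume "(\<phi>, \<phi>') \<in> iso_rel G D"
  moreover from this have "(\<phi>', \<phi>) \<in> iso_rel G D"
    using equiv_iso_rel[of G D] by (meson equivE symD)
  ultimately show "symmetric_support G D \<phi> = symmetric_support G D \<phi>'" using sub by (simp add: subset_antisym)
qed

text \<open>Choose \<open>B t\<close> spanning each component. An antilinear map \<open>B t \<mapsto> l t B t\<close> is an
  anti-automorphism iff \<open>l\<close> trivialises the symmetric cocycle \<open>f\<close> below.\<close>

lemma involutions_nonempty: "involutions \<noteq> {}"
proof -
  \<comment> \<open>Fixing \<open>B \<one>\<close> as the identity normalises the structure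
    constants \<open>c\<close>, hence also \<open>f\<close> and \<open>l\<close>, at
    \<open>\<one>\<close>.\<close>
  define B where "B t = (if t = \<one> then mat 1 else SOME X. X \<in> D t \<and> X \<noteq> 0)" for t
  have B: "B t \<in> D t" "B t \<noteq> 0" if t: "t \<in> T" for t
  proof -
    have "\<exists>X. X \<in> D t \<and> X \<noteq> 0" using ex_nonzero[OF t] by blast
    from someI_ex[OF this] show "B t \<in> D t" "B t \<noteq> 0"
      using mat_1_neq_0 scalar_in_D[of 1] by (auto simp: B_def)
  qed
  have B1: "B \<one> = mat 1" by (simp add: B_def)
  have BB: "B s ** B t \<in> D (s \<otimes> t)" "B s ** B t \<noteq> 0" if s: "s \<in> T" and t: "t \<in> T" for s t
    using D_mult[OF T_carrier[OF s] T_carrier[OF t] B(1)[OF s] B(1)[OF t]]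
      D_mult_eq_0[OF T_carrier[OF s] B[OF s]] B(2)[OF t] by simp_all
  have "\<exists>c. B s ** B t = c *\<^sub>C B (s \<otimes> t)" if s: "s \<in> T" and t: "t \<in> T" for s t
    by (rule homogeneous_proportional[OF T_mult B(1)[OF T_mult] B(2)[OF T_mult] BB(1)]; rule s t)
  then obtain c where c: "\<And>s t. s \<in> T \<Longrightarrow> t \<in> T \<Longrightarrow> B s ** B t = c s t *\<^sub>C B (s \<otimes> t)" by metis
  have c0: "c s t \<noteq> 0" if "s \<in> T" "t \<in> T" for s t
    using BB(2)[OF that] c[OF that] by auto
  have c_one: "c \<one> t = 1" "c t \<one> = 1" if t: "t \<in> T" for t
    using c[OF T_one t] c[OF t T_one] T_carrier[OF t] cscale_cancel_right[OF B(2)[OF t], of 1]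
    by (simp_all add: B1)
  have c_assoc: "c r s * c (r \<otimes> s) t = c s t * c r (s \<otimes> t)"
    if r: "r \<in> T" and s: "s \<in> T" and t: "t \<in> T" for r s t
  proof -
    have "(B r ** B s) ** B t = B r ** (B s ** B t)" by (simp add: matrix_mul_assoc)
    then have "(c r s * c (r \<otimes> s) t) *\<^sub>C B (r \<otimes> s \<otimes> t) = (c s t * c r (s \<otimes> t)) *\<^sub>C B (r \<otimes> s \<otimes> t)"
      using r s t T_carrier T_mult by (simp add: c m_assoc)
    then show ?thesis by (simp only: cscale_cancel_right[OF B(2)[OF T_mult[OF T_mult[OF r s] t]]])
  qed
  have c_norm: "c s t * cnj (c s t) = c t s * cnj (c t s)" if s: "s \<in> T" and t: "t \<in> T" for s t
  proof -
    obtain b where b: "norm b = 1" "B s ** B t = b *\<^sub>C (B t ** B s)"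
      using homogeneous_commute[OF s B(1)[OF s] t B(1)[OF t]] by blast
    have "c s t *\<^sub>C B (s \<otimes> t) = (b * c t s) *\<^sub>C B (s \<otimes> t)"
      using b(2) c[OF s t] c[OF t s] m_comm[OF T_carrier[OF s] T_carrier[OF t]] by simp
    then have "c s t = b * c t s" by (simp only: cscale_cancel_right[OF B(2)[OF T_mult[OF s t]]])
    then have "norm (c s t) = norm (c t s)" using b(1) by (simp add: norm_mult)
    then show ?thesis by (metis complex_norm_square)
  qed
  \<comment> \<open>Comparing \<open>\<phi> (B s ** B t)\<close> with
    \<open>\<phi> (B t) ** \<phi> (B s)\<close> demands
    \<open>l t * l s = cnj (c s t) / c t s * l (s \<otimes> t)\<close>, whose factor is
    \<open>f t s\<close>.\<close>
  define f where "f s t = cnj (c t s) / c s t" for s t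
  interpret H: comm_group "G\<lparr>carrier := T\<rparr>"
    by (rule group.group_comm_groupI[OF subgroup_imp_group[OF T_subgroup]])
       (simp add: m_comm T_carrier)
  have f0: "f s t \<noteq> 0" if "s \<in> T" "t \<in> T" for s t using c0 that by (simp add: f_def)
  have f_sym: "f s t = f t s" if s: "s \<in> T" and t: "t \<in> T" for s t
    using c_norm[OF s t] c0[OF s t] c0[OF t s] by (simp add: f_def field_simps)
  have f_coc: "f r s * f (r \<otimes> s) t = f s t * f r (s \<otimes> t)"
    if r: "r \<in> T" and s: "s \<in> T" and t: "t \<in> T" for r s t
  proof -
    \<comment> \<open>The numerators of the cocycle identity come from conjugating associativity in
      the reversed order \<open>t\<close>, \<open>s\<close>, \<open>r\<close>; the denominators come
      from the order \<open>r\<close>, \<open>s\<close>, \<open>t\<close>.\<close>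
    have "c s r * c t (r \<otimes> s) = c t s * c (s \<otimes> t) r"
      using c_assoc[OF t s r] m_comm r s t T_carrier by simp
    then have "cnj (c s r) * cnj (c t (r \<otimes> s)) = cnj (c t s) * cnj (c (s \<otimes> t) r)"
      by (metis complex_cnj_mult)
    then show ?thesis using c_assoc[OF r s t] by (simp add: f_def)
  qed
  have f_one: "f \<one> t = 1" if "t \<in> T" for t using c_one[OF that] by (simp add: f_def)
  have "\<exists>l. (\<forall>t\<in>T. l t \<noteq> 0) \<and> (\<forall>s\<in>T. \<forall>t\<in>T. l s * l t = f s t * l (s \<otimes> t))"
    using H.symmetric_cocycle_is_coboundary[of f] finite_T f0 f_sym f_coc f_one by simp
  then obtain l where l0: "\<And>t. t \<in> T \<Longrightarrow> l t \<noteq> 0"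
    and l: "\<And>s t. s \<in> T \<Longrightarrow> t \<in> T \<Longrightarrow> l s * l t = f s t * l (s \<otimes> t)" by blast
  \<comment> \<open>As \<open>f\<close> has modulus one, the norm of \<open>l\<close> is itself a
    character of the finite group \<open>T\<close>, hence constantly 1. This is what makes the
    antilinear map an involution.\<close>
  have l_norm: "l t * cnj (l t) = 1" if t: "t \<in> T" for t
  proof -
    have "norm (f s t) = 1" if s: "s \<in> T" and t: "t \<in> T" for s t
    proof -
      have "norm (c s t) ^ 2 = norm (c t s) ^ 2"
        using c_norm[OF s t] unfolding complex_norm_square[symmetric] of_real_eq_iff .
      then have "norm (c s t) = norm (c t s)" by (simp add: power2_eq_iff_nonneg)
      then show ?thesis using c0[OF s t] c0[OF t s] by (simp add: f_def norm_divide)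
    qed
    then have "norm (l (s \<otimes> t)) = norm (l s) * norm (l t)" if "s \<in> T" "t \<in> T" for s t
      using arg_cong[OF l[OF that], of norm] that by (simp add: norm_mult)
    then have "character_on G T (\<lambda>t. of_real (norm (l t)))"
      using l0 by (simp add: character_on_def)
    then have "norm (l t) = 1" using character_on_norm[OF T_subgroup _ finite_T t] by force
    then show ?thesis using complex_norm_square[of "l t"] by simp
  qed
  have l_one: "l \<one> = 1" using l[OF T_one T_one] f_one[OF T_one] l0[OF T_one] by simp
  have "\<exists>z. X = z *\<^sub>C B t" if "t \<in> T" "X \<in> D t" for t X
    using homogeneous_proportional[OF that(1) B[OF that(1)] that(2)] .
  then obtain a where a: "\<And>t X. t \<in> T \<Longrightarrow> X \<in> D t \<Longrightarrow> X = a t X *\<^sub>C B t" by metis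
  have a_eq: "a t X = z" if t: "t \<in> T" and X: "X = z *\<^sub>C B t" for t X z
  proof -
    have "a t X *\<^sub>C B t = z *\<^sub>C B t"
      using a[OF t, of X] D_cscale[OF T_carrier[OF t] B(1)[OF t], of z] X by simp
    then show ?thesis by (simp only: cscale_cancel_right[OF B(2)[OF t]])
  qed
  \<comment> \<open>The coordinate \<open>a t X\<close> is meaningful only for \<open>X\<close> in
    \<open>D t\<close>; \<open>extend\<close> evaluates it nowhere else.\<close>
  define \<phi> where "\<phi> = extend (\<lambda>t X. (cnj (a t X) * l t) *\<^sub>C B t)"
  have lin: "linear \<phi>"
    unfolding \<phi>_def
  proof (rule linear_extend)
    fix t X Y and r :: real assume t: "t \<in> T" and X: "X \<in> D t"
    have "a t (r *\<^sub>R X) = of_real r * a t X"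
      using a[OF t X] by (intro a_eq[OF t]) (metis scaleR_eq_cscale cscale_cscale)
    then show "(cnj (a t (r *\<^sub>R X)) * l t) *\<^sub>C B t = r *\<^sub>R ((cnj (a t X) * l t) *\<^sub>C B t)"
      by (simp add: scaleR_eq_cscale mult.assoc)
    assume Y: "Y \<in> D t"
    have "a t (X + Y) = a t X + a t Y"
      using a[OF t X] a[OF t Y] by (intro a_eq[OF t]) (metis cscale_add_left)
    then show "(cnj (a t (X + Y)) * l t) *\<^sub>C B t =
        (cnj (a t X) * l t) *\<^sub>C B t + (cnj (a t Y) * l t) *\<^sub>C B t"
      by (simp add: distrib_right cscale_add_left)
  qed
  have \<phi>: "\<phi> (z *\<^sub>C B t) = (cnj z * l t) *\<^sub>C B t" if t: "t \<in> T" for t z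
  proof -
    have "a s 0 = 0" if "s \<in> T" for s using a_eq[OF that, of 0 0] by simp
    then have "\<phi> (z *\<^sub>C B t) = (cnj (a t (z *\<^sub>C B t)) * l t) *\<^sub>C B t"
      unfolding \<phi>_def using D_cscale[OF T_carrier[OF t] B(1)[OF t]] t
      by (intro extend_homogeneous) auto
    then show ?thesis using a_eq[OF t refl] by simp
  qed
  have "\<phi> \<in> involutions"
  proof (rule involutionI[OF lin])
    fix s X assume s: "s \<in> T" "X \<in> D s"
    then obtain x where x: "X = x *\<^sub>C B s" using a by blast
    show "\<phi> X \<in> D s" unfolding x \<phi>[OF s(1)] by (rule D_cscale[OF T_carrier[OF s(1)] B(1)[OF s(1)]])
    have "cnj (cnj x * l s) * l s = x * (l s * cnj (l s))" by (simp add: mult_ac)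
    also have "\<dots> = x" by (simp only: l_norm[OF s(1)] mult_1_right)
    finally show "\<phi> (\<phi> X) = X" unfolding x \<phi>[OF s(1)] by (simp only:)
    fix t Y assume t: "t \<in> T" "Y \<in> D t"
    then obtain y where y: "Y = y *\<^sub>C B t" using a by blast
    have "X ** Y = (x * y * c s t) *\<^sub>C B (s \<otimes> t)"
      unfolding x y using c[OF s(1) t(1)] by (simp add: mult_ac)
    then have "\<phi> (X ** Y) = (cnj (x * y * c s t) * l (s \<otimes> t)) *\<^sub>C B (s \<otimes> t)"
      using \<phi>[OF T_mult[OF s(1) t(1)]] by simp
    moreover have "\<phi> Y ** \<phi> X = (cnj y * l t * (cnj x * l s) * c t s) *\<^sub>C B (s \<otimes> t)"
      unfolding x y \<phi>[OF s(1)] \<phi>[OF t(1)]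
      using c[OF t(1) s(1)] m_comm[OF T_carrier[OF s(1)] T_carrier[OF t(1)]] by (simp add: mult_ac)
    moreover have "cnj (c s t) * l (s \<otimes> t) = l t * l s * c t s"
      using l[OF t(1) s(1)] c0[OF t(1) s(1)] m_comm[OF T_carrier[OF s(1)] T_carrier[OF t(1)]]
      by (simp add: f_def)
    then have "cnj (x * y * c s t) * l (s \<otimes> t) = cnj y * l t * (cnj x * l s) * c t s"
      by (simp add: mult_ac)
    ultimately show "\<phi> (X ** Y) = \<phi> Y ** \<phi> X" by (simp only:)
  next
    show "\<phi> (mat \<i>) = - mat \<i>"
      using \<phi>[OF T_one, of \<i>] by (simp add: B1 l_one mat_eq_cscale[of \<i>] cscale_uminus)
  qed
  then show ?thesis by blast
qed

lemma symmetric_support_surj: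
  assumes S: "S \<in> subgroups_index_1_or_2 (G\<lparr>carrier := T2\<rparr>)"
  shows "\<exists>\<phi>\<in>involutions. symmetric_support G D \<phi> = S"
proof -
  obtain \<phi>0 where \<phi>0: "\<phi>0 \<in> involutions" using involutions_nonempty by blast
  define S0 where "S0 = symmetric_support G D \<phi>0"
  have S0: "S0 \<in> subgroups_index_1_or_2 (G\<lparr>carrier := T2\<rparr>)"
    unfolding S0_def by (rule symmetric_support_index[OF \<phi>0])
  \<comment> \<open>This is the product of the sign characters of \<open>S\<close> and
    \<open>S0\<close>, so twisting by an extension of it replaces the sign character of
    \<open>S0\<close> by that of \<open>S\<close>.\<close>
  define \<epsilon> :: "'g \<Rightarrow> complex" where "\<epsilon> t = (if t \<in> S \<longleftrightarrow> t \<in> S0 then 1 else - 1)" for t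
  have mem: "s \<otimes> t \<in> S \<longleftrightarrow> (s \<in> S \<longleftrightarrow> t \<in> S)" "s \<otimes> t \<in> S0 \<longleftrightarrow> (s \<in> S0 \<longleftrightarrow> t \<in> S0)"
    if "s \<in> T2" "t \<in> T2" for s t
    using S S0 that unfolding index_1_or_2_iff by blast+
  have "character_on G T2 \<epsilon>" unfolding character_on_def by (auto simp: \<epsilon>_def mem)
  from character_extend[OF finite_T subgroup.subset[OF T_subgroup] T2_subgroup this]
  obtain K h where K: "T \<union> T2 \<subseteq> K" "character_on G K h" "\<forall>t\<in>T2. h t = \<epsilon> t"
    by (elim exE conjE)
  have h: "character_on G T h" using character_on_subset[OF K(2)] K(1) by blast
  have "t \<in> symmetric_support G D (twist h \<circ> \<phi>0) \<longleftrightarrow> t \<in> S" if t: "t \<in> T2" for t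
    using symmetric_support_twist[OF \<phi>0 h t] K(3) t by (auto simp: \<epsilon>_def S0_def)
  moreover have "symmetric_support G D (twist h \<circ> \<phi>0) \<subseteq> T2" by (auto simp: symmetric_support_def)
  moreover have "S \<subseteq> T2" using S unfolding index_1_or_2_iff by blast
  ultimately have "symmetric_support G D (twist h \<circ> \<phi>0) = S" by blast
  then show ?thesis using twist_involution[OF \<phi>0 h] by blast
qed

lemma symmetric_support_bijection:
  "\<exists>F. (\<forall>\<phi>\<in>involutions. F (iso_rel G D `` {\<phi>}) = symmetric_support G D \<phi>) \<and>
       bij_betw F (involutions // iso_rel G D) (subgroups_index_1_or_2 (G\<lparr>carrier := T2\<rparr>))"
proof -
  note equiv = equiv_iso_rel[of G D]
  \<comment> \<open>The choice of representative is harmless, since \<open>iso_rel_iff\<close> makes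
    the support constant on each class.\<close>
  define F where "F C = symmetric_support G D (SOME \<phi>. \<phi> \<in> C)" for C
  have F: "F (iso_rel G D `` {\<phi>}) = symmetric_support G D \<phi>" if \<phi>: "\<phi> \<in> involutions" for \<phi>
  proof -
    define \<phi>' where "\<phi>' = (SOME \<phi>'. \<phi>' \<in> iso_rel G D `` {\<phi>})"
    have "\<phi> \<in> iso_rel G D `` {\<phi>}" by (rule equiv_class_self[OF equiv \<phi>])
    then have "\<phi>' \<in> iso_rel G D `` {\<phi>}"
      unfolding \<phi>'_def by (rule someI[where P = "\<lambda>\<phi>'. \<phi>' \<in> iso_rel G D `` {\<phi>}"])
    then have rel: "(\<phi>, \<phi>') \<in> iso_rel G D" by simp
    then have "\<phi>' \<in> involutions" by (simp add: iso_rel_def)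
    then have "symmetric_support G D \<phi> = symmetric_support G D \<phi>'" using rel iso_rel_iff[OF \<phi>] by blast
    then show ?thesis unfolding F_def \<phi>'_def ..
  qed
  have "bij_betw F (involutions // iso_rel G D) (subgroups_index_1_or_2 (G\<lparr>carrier := T2\<rparr>))"
  proof (rule bij_betwI')
    fix C C' assume CC': "C \<in> involutions // iso_rel G D" "C' \<in> involutions // iso_rel G D"
    obtain \<phi> \<phi>' where \<phi>: "\<phi> \<in> involutions" "C = iso_rel G D `` {\<phi>}"
      and \<phi>': "\<phi>' \<in> involutions" "C' = iso_rel G D `` {\<phi>'}"
      using CC' by (elim quotientE)
    show "F C = F C' \<longleftrightarrow> C = C'"
      unfolding \<phi>(2) \<phi>'(2) F[OF \<phi>(1)] F[OF \<phi>'(1)] eq_equiv_class_iff[OF equiv \<phi>(1) \<phi>'(1)]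
      using iso_rel_iff[OF \<phi>(1) \<phi>'(1)] by simp
  next
    fix C assume "C \<in> involutions // iso_rel G D"
    then obtain \<phi> where \<phi>: "\<phi> \<in> involutions" "C = iso_rel G D `` {\<phi>}" by (elim quotientE)
    show "F C \<in> subgroups_index_1_or_2 (G\<lparr>carrier := T2\<rparr>)"
      unfolding \<phi>(2) F[OF \<phi>(1)] by (rule symmetric_support_index[OF \<phi>(1)])
  next
    fix S assume "S \<in> subgroups_index_1_or_2 (G\<lparr>carrier := T2\<rparr>)"
    then obtain \<phi> where \<phi>: "\<phi> \<in> involutions" "symmetric_support G D \<phi> = S"
      using symmetric_support_surj by blast
    show "\<exists>C\<in>involutions // iso_rel G D. S = F C"
      using quotientI[OF \<phi>(1)] F[OF \<phi>(1)] \<phi>(2) by (intro bexI[of _ "iso_rel G D `` {\<phi>}"]) simp_all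
  qed
  with F show ?thesis by blast
qed

end

theorem mainTheorem9:
  fixes G :: "('g, 'b) monoid_scheme"
    and D :: "'g \<Rightarrow> (complex ^ ('n::finite) ^ 'n) set"
  assumes "comm_group G"
    and "is_division_grading G D"
    and "D \<one>\<^bsub>G\<^esub> = matrix_center"
  shows "\<exists>F. (\<forall>\<phi> \<in> second_kind_involutions G D.
                 F (iso_rel G D `` {\<phi>}) = symmetric_support G D \<phi>) \<and>
             bij_betw F (second_kind_involutions G D // iso_rel G D)
               (subgroups_index_1_or_2 (G\<lparr>carrier := support_2 G D\<rparr>))"
proof -
  interpret comm_group G by (rule assms)
  interpret central_division_grading G D by unfold_locales (rule assms)+
  show ?thesis by (rule symmetric_support_bijection)
qed

end
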